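(* Let $\mathcal Z=\{\bm z\in\mathbb R^{d_{\bm z}}\mid c_\ell(\bm z)\le 0\ \forall \ell\in\mathcal L\}$ be nonempty, where $\mathcal L=\{1,\dots,L\}$, $\mathcal L_0=\{0,\dots,L\}$, and each $c_\ell:\mathbb R^{d_{\bm z}}\to\overline{\mathbb R}$ is proper, closed and convex. Let $\mathcal I=\{1,\dots,I\}$, $\mathcal I_0=\{0,\dots,I\}$, and for every $i\in\mathcal I_0$ let $f_i:\mathbb R^{d_{\bm x}}\times\mathbb R^{d_{\bm z}}\to\overline{\mathbb R}$ be such that $f_i(\cdot,\bm z)$ is proper, closed and convex for every fixed $\bm z$ and $-f_i(\bm x,\cdot)$ is proper, closed and convex for every fixed $\bm x$. Consider $$\text{(P-W)}\qquad \inf_{\bm x\in\mathbb R^{d_{\bm x}}}\Big\{\sup_{\bm z_0\in\mathcal Z}f_0(\bm x,\bm z_0)\ \Big|\ \sup_{\bm z_i\in\mathcal Z}f_i(\bm x,\bm z_i)\le 0\ \ \forall i\in\mathcal I\Big\}$$ and $$\text{(P-W}'\text{)}\qquad\begin{array}{cl}\inf & (-f_0)^{*2}(\bm x,\bm y_{00})+\sum_{\ell\in\mathcal L}\nu_{0\ell}c_\ell^*(\bm y_{0\ell}/\nu_{0\ell})\\ \text{s.t.}& (-f_i)^{*2}(\bm x,\bm y_{i0})+\sum_{\ell\in\mathcal L}\nu_{i\ell}c_\ell^*(\bm y_{i\ell}/\nu_{i\ell})\le 0\quad\forall i\in\mathcal I\\ & \sum_{\ell\in\mathcal L_0}\bm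 y_{i\ell}=\bm 0\quad\forall i\in\mathcal I_0\\ & \bm x\in\mathbb R^{d_{\bm x}},\ \bm y_{i\ell}\in\mathbb R^{d_{\bm z}}\ (i\in\mathcal I_0,\ell\in\mathcal L_0),\ \nu_{i\ell}\ge 0\ (i\in\mathcal I_0,\ell\in\mathcal L).\end{array}$$ Then the following hold. (i) The infimum of (P-W) is smaller than or equal to that of (P-W$'$). (ii) If $\mathcal Z$ (in the representation $\mathcal Z=\{\bm z\in\mathbb R^{d_{\bm z}}\mid c_\ell(\bm z)\le 0\ \forall \ell\in\mathcal L\}$) admits a Slater point, then the infima of (P-W) and (P-W$'$) coincide, and (P-W) is solvable if and only if (P-W$'$) is solvable. (iii) If $\mathcal Z$ is compact and (P-W) admits a strict Slater point, then the infima of (P-W) and (P-W$'$) coincide, and (P-W) is solvable whenever (P-W$'$) is solvable.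
   Context: $\overline{\mathbb R}=[-\infty,+\infty]$. For $f:\mathbb R^d\to\overline{\mathbb R}$: $\mathrm{dom}(f)=\{\bm x\mid f(\bm x)<+\infty\}$; $f$ is proper if $f>-\infty$ everywhere and $\mathrm{dom}(f)\ne\emptyset$; $f$ is closed if it is lower semicontinuous and either $f>-\infty$ everywhere or $f\equiv-\infty$; $f^*(\bm w)=\sup_{\bm x}\{\bm w^\top\bm x-f(\bm x)\}$. The support function of a set $\mathcal X$ is $\delta^*_{\mathcal X}(\bm w)=\sup_{\bm x\in\mathcal X}\bm x^\top\bm w$. Partial conjugate: $f^{*2}(\bm x,\bm y)=\sup_{\bm z}\{\bm y^\top\bm z-f(\bm x,\bm z)\}$. Perspective: for $f$ proper, closed and convex, $tf(\bm x/t)$ has its usual meaning for $t>0$, and for $t=0$ it denotes $\delta^*_{\mathrm{dom}(f^* )}(\bm x)$ (applied here with $f=c_\ell^*$). Optimization conventions: a solution (any assignment of real values to the decision variables) is feasible if it satisfies all constraints and its objective value is not $+\infty$ (minimization) or not $-\infty$ (maximization). A feasible problem is solvable if its optimal value is attained by a feasible solution; an infeasible problem is regarded as solved by any solution (hence solvable), and its optimal value is $+\infty$ (minimization) or $-\infty$ (maximization). Slater points: let $\mathcal X=\{\bm x\mid f_i(\bm x)\le 0\ \forall i\in\mathcal I,\ h_j(\bm x)=0\ \forall j\in\mathcal J\}$ be a set with this given representation. $\bm x^{\rm S}$ is a Slater point of $\mathcal X$ if (a) $\bm x^{\rm S}\in\mathrm{ri}(\mathrm{dom}(f_i))$ and $\bm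 x^{\rm S}\in\mathrm{ri}(\mathrm{dom}(h_j))$ for all $i,j$, (b) $\bm x^{\rm S}\in\mathcal X$, and (c) $f_i(\bm x^{\rm S})<0$ for all $i$ such that $f_i$ is nonlinear (i.e. not affine). It is strict if $f_i(\bm x^{\rm S})<0$ for all $i\in\mathcal I$. A (strict) Slater point of $\inf\{f_0(\bm x)\mid\bm x\in\mathcal X\}$ is a (strict) Slater point of $\mathcal X$ that lies in $\mathrm{ri}(\mathrm{dom}(f_0))$. Here $\mathrm{ri}$ denotes relative interior. For (P-W) the objective and constraint functions are $\bm x\mapsto\sup_{\bm z\in\mathcal Z}f_i(\bm x,\bm z)$. *)

theory Defs
  imports "HOL-Analysis.Analysis"
begin

section \<open>Extended real-valued convex functions\<close>

definition edom :: "('a \<Rightarrow> ereal) \<Rightarrow> 'a set" where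
  "edom f = {x. f x < \<infinity>}"

definition proper_fun :: "('a \<Rightarrow> ereal) \<Rightarrow> bool" where
  "proper_fun f \<longleftrightarrow> (\<forall>x. f x > -\<infinity>) \<and> edom f \<noteq> {}"

definition lsc_fun :: "('a::topological_space \<Rightarrow> ereal) \<Rightarrow> bool" where
  "lsc_fun f \<longleftrightarrow> (\<forall>x. f x \<le> Liminf (at x) f)"

definition closed_fun :: "('a::topological_space \<Rightarrow> ereal) \<Rightarrow> bool" where
  "closed_fun f \<longleftrightarrow> lsc_fun f \<and> ((\<forall>x. f x > -\<infinity>) \<or> (\<forall>x. f x = -\<infinity>))"

text \<open>Convexity of the epigraph; the library's \<^const>\<open>convex_on\<close> covers real-valued functions only,
  and this form needs no convention for \<open>\<infinity> - \<infinity>\<close>.\<close>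
definition convex_fun :: "('a::real_vector \<Rightarrow> ereal) \<Rightarrow> bool" where
  "convex_fun f \<longleftrightarrow> convex {(x, r::real). f x \<le> ereal r}"

definition proper_closed_convex :: "('a::real_normed_vector \<Rightarrow> ereal) \<Rightarrow> bool" where
  "proper_closed_convex f \<longleftrightarrow> proper_fun f \<and> closed_fun f \<and> convex_fun f"

definition affine_fun :: "('a::real_inner \<Rightarrow> ereal) \<Rightarrow> bool" where
  "affine_fun f \<longleftrightarrow> (\<exists>a b. \<forall>x. f x = ereal (a \<bullet> x + b))"

definition conjugate :: "('a::real_inner \<Rightarrow> ereal) \<Rightarrow> 'a \<Rightarrow> ereal" where
  "conjugate f w = (SUP x. ereal (w \<bullet> x) - f x)"

definition partial_conjugate2 ::
    "('a \<Rightarrow> 'b::real_inner \<Rightarrow> ereal) \<Rightarrow> 'a \<Rightarrow> 'b \<Rightarrow> ereal" where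
  "partial_conjugate2 f x y = (SUP z. ereal (y \<bullet> z) - f x z)"

definition support_fun :: "'a::real_inner set \<Rightarrow> 'a \<Rightarrow> ereal" where
  "support_fun X w = (SUP x\<in>X. ereal (x \<bullet> w))"

text \<open>Only used for \<open>t \<ge> 0\<close>; the second branch is meant for \<open>t = 0\<close>.\<close>
definition perspective :: "('a::real_inner \<Rightarrow> ereal) \<Rightarrow> real \<Rightarrow> 'a \<Rightarrow> ereal" where
  "perspective f t x =
     (if t > 0 then ereal t * f (x /\<^sub>R t) else support_fun (edom (conjugate f)) x)"

section \<open>Minimization problems\<close>

text \<open>A minimization problem is given by the set \<open>C\<close> of the assignments that satisfy all constraints
  and an objective \<open>F\<close>. If \<open>F = \<infinity>\<close> on all of \<open>C\<close>, in particular if \<open>C = {}\<close>,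
  the optimal value is \<open>\<infinity>\<close>.\<close>

definition feasible :: "'v set \<Rightarrow> ('v \<Rightarrow> ereal) \<Rightarrow> 'v \<Rightarrow> bool" where
  "feasible C F v \<longleftrightarrow> v \<in> C \<and> F v \<noteq> \<infinity>"

definition optimal_value :: "'v set \<Rightarrow> ('v \<Rightarrow> ereal) \<Rightarrow> ereal" where
  "optimal_value C F = (INF v\<in>C. F v)"

definition solvable :: "'v set \<Rightarrow> ('v \<Rightarrow> ereal) \<Rightarrow> bool" where
  "solvable C F \<longleftrightarrow>
     ((\<exists>v. feasible C F v) \<longrightarrow> (\<exists>v. feasible C F v \<and> F v = optimal_value C F))"

section \<open>Slater points\<close>

text \<open>A set is represented by the inequalities \<open>g i x \<le> 0\<close> for \<open>i \<in> I\<close>;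
  no equality constraints occur in the sets to which these notions are applied.\<close>

definition sublevel_set :: "'i set \<Rightarrow> ('i \<Rightarrow> 'a \<Rightarrow> ereal) \<Rightarrow> 'a set" where
  "sublevel_set I g = {x. \<forall>i\<in>I. g i x \<le> 0}"

definition slater_point ::
    "'i set \<Rightarrow> ('i \<Rightarrow> 'a::euclidean_space \<Rightarrow> ereal) \<Rightarrow> 'a \<Rightarrow> bool" where
  "slater_point I g x \<longleftrightarrow>
     (\<forall>i\<in>I. x \<in> rel_interior (edom (g i))) \<and> x \<in> sublevel_set I g \<and>
     (\<forall>i\<in>I. \<not> affine_fun (g i) \<longrightarrow> g i x < 0)"

definition strict_slater_point ::
    "'i set \<Rightarrow> ('i \<Rightarrow> 'a::euclidean_space \<Rightarrow> ereal) \<Rightarrow> 'a \<Rightarrow> bool" where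
  "strict_slater_point I g x \<longleftrightarrow> slater_point I g x \<and> (\<forall>i\<in>I. g i x < 0)"

definition problem_strict_slater_point ::
    "('a::euclidean_space \<Rightarrow> ereal) \<Rightarrow> 'i set \<Rightarrow> ('i \<Rightarrow> 'a \<Rightarrow> ereal) \<Rightarrow> 'a \<Rightarrow> bool" where
  "problem_strict_slater_point g0 I g x \<longleftrightarrow>
     strict_slater_point I g x \<and> x \<in> rel_interior (edom g0)"

section \<open>The robust problem and its dual reformulation\<close>

definition worst_case :: "'b set \<Rightarrow> (nat \<Rightarrow> 'a \<Rightarrow> 'b \<Rightarrow> ereal) \<Rightarrow> nat \<Rightarrow> 'a \<Rightarrow> ereal" where
  "worst_case Z f i x = (SUP z\<in>Z. f i x z)"

definition PW_constraints :: "nat \<Rightarrow> 'b set \<Rightarrow> (nat \<Rightarrow> 'a \<Rightarrow> 'b \<Rightarrow> ereal) \<Rightarrow> 'a set" where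
  "PW_constraints I Z f = sublevel_set {1..I} (worst_case Z f)"

definition PW_objective :: "'b set \<Rightarrow> (nat \<Rightarrow> 'a \<Rightarrow> 'b \<Rightarrow> ereal) \<Rightarrow> 'a \<Rightarrow> ereal" where
  "PW_objective Z f = worst_case Z f 0"

text \<open>The decision variables of the reformulation are triples \<open>(x, y, \<nu>)\<close>. Only the entries
  \<open>y i l\<close> with \<open>i \<le> I\<close>, \<open>l \<le> L\<close> and \<open>\<nu> i l\<close> with \<open>i \<le> I\<close>, \<open>1 \<le> l \<le> L\<close> are relevant; the
  others are unconstrained and do not enter the objective.\<close>

definition PW'_expr ::
    "nat \<Rightarrow> (nat \<Rightarrow> 'b::real_inner \<Rightarrow> ereal) \<Rightarrow> (nat \<Rightarrow> 'a \<Rightarrow> 'b \<Rightarrow> ereal) \<Rightarrow> nat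
      \<Rightarrow> 'a \<times> (nat \<Rightarrow> nat \<Rightarrow> 'b) \<times> (nat \<Rightarrow> nat \<Rightarrow> real) \<Rightarrow> ereal" where
  "PW'_expr L c f i = (\<lambda>(x, y, \<nu>).
     partial_conjugate2 (\<lambda>x z. - f i x z) x (y i 0) +
     (\<Sum>l\<in>{1..L}. perspective (conjugate (c l)) (\<nu> i l) (y i l)))"

definition PW'_constraints ::
    "nat \<Rightarrow> nat \<Rightarrow> (nat \<Rightarrow> 'b::real_inner \<Rightarrow> ereal) \<Rightarrow> (nat \<Rightarrow> 'a \<Rightarrow> 'b \<Rightarrow> ereal)
      \<Rightarrow> ('a \<times> (nat \<Rightarrow> nat \<Rightarrow> 'b) \<times> (nat \<Rightarrow> nat \<Rightarrow> real)) set" where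
  "PW'_constraints I L c f = {(x, y, \<nu>).
     (\<forall>i\<in>{1..I}. PW'_expr L c f i (x, y, \<nu>) \<le> 0) \<and>
     (\<forall>i\<in>{0..I}. (\<Sum>l\<in>{0..L}. y i l) = 0) \<and>
     (\<forall>i\<in>{0..I}. \<forall>l\<in>{1..L}. \<nu> i l \<ge> 0)}"

definition PW'_objective ::
    "nat \<Rightarrow> (nat \<Rightarrow> 'b::real_inner \<Rightarrow> ereal) \<Rightarrow> (nat \<Rightarrow> 'a \<Rightarrow> 'b \<Rightarrow> ereal)
      \<Rightarrow> 'a \<times> (nat \<Rightarrow> nat \<Rightarrow> 'b) \<times> (nat \<Rightarrow> nat \<Rightarrow> real) \<Rightarrow> ereal" where
  "PW'_objective L c f = PW'_expr L c f 0"

end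

theory Submission
  imports Defs
begin

text \<open>
  Properness of \<open>f i\<close> in both arguments makes it real-valued, so for fixed \<open>x\<close> each worst case is
  the maximization over \<open>Z\<close> of a finite concave function, and the reformulation is its Lagrange--Fenchel
  dual. Weak duality is Young's inequality. With a Slater point, one first multiplies out the
  nonlinear constraints, then the affine ones, and finally splits the Lagrangian into one conjugate
  per constraint; the dual optimum is attained. If \<open>Z\<close> is compact, the constraints can be replaced
  by finitely many of their affine minorants at an arbitrarily small loss; moving \<open>x\<close> slightly
  towards the strict Slater point of (P-W) leaves room for that loss in the constraints.
\<close>

section \<open>Lagrange multipliers for real-valued functions\<close>

text \<open>The constraint functions take the value infinity, so the multiplier arguments work on a
  convex set \<open>S\<close> where everything is real-valued; the domains disappear only when each
  is absorbed into a conjugate. That absorption and the affine constraints need a relative interior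
  point, the nonlinear constraints a strict point. Multiplying out the latter while the affine ones
  still cut down the ground set matches this: the affine step runs over the intersection of the
  domains, where clause (a) of the Slater condition puts the point in the relative interior. The two
  duality theorems differ in the bound that they certify. With a Slater point,
  \<open>m \<le> g\<close> on the feasible set suffices, so the exact worst case is certified at the
  same \<open>x\<close> and solutions transfer in both directions. The compactness argument covers
  only strict inequalities \<open>m < g\<close>; its certified values merely approach the worst
  case, at shifted points \<open>x\<close>, which gives equal infima but constructs no optimal
  solution of the reformulation.\<close>

lemma convex_on_affine_fun:
  "convex S \<Longrightarrow> convex_on S (\<lambda>z. a \<bullet> z + (b::real))"
  by (rule convex_onI) (auto simp: inner_add_right algebra_simps)

lemma convex_on_sum_fun:
  fixes h :: "'i \<Rightarrow> 'a::real_vector \<Rightarrow> real"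
  assumes "convex S" and "\<And>i. i \<in> A \<Longrightarrow> convex_on S (h i)"
  shows "convex_on S (\<lambda>z. \<Sum>i\<in>A. h i z)"
  using assms(2) by (induction A rule: infinite_finite_induct)
    (auto simp: convex_on_const assms(1) intro!: convex_on_add)

lemma convex_sublevel:
  assumes "convex_on S q"
  shows "convex {z\<in>S. q z \<le> (r::real)}"
proof (rule convexI)
  fix x y u v
  assume A: "x \<in> {z\<in>S. q z \<le> r}" "y \<in> {z\<in>S. q z \<le> r}"
    and u: "(0::real) \<le> u" "0 \<le> v" "u + v = 1"
  have "q (u *\<^sub>R x + v *\<^sub>R y) \<le> u * q x + v * q y"
    using assms A u by (auto simp: convex_on_def)
  also have "\<dots> \<le> u * r + v * r"
    using A u by (intro add_mono mult_left_mono) auto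
  also have "\<dots> = r" using u by (simp flip: distrib_right)
  finally show "u *\<^sub>R x + v *\<^sub>R y \<in> {z\<in>S. q z \<le> r}"
    using convex_on_imp_convex[OF assms] A u by (auto simp: convexD)
qed

lemma convex_constraints:
  assumes "convex S" "\<And>l. l \<in> N \<Longrightarrow> convex_on S (q l)"
  shows "convex {z\<in>S. \<forall>l\<in>N. q l z \<le> (0::real)}"
proof -
  have eq: "{z\<in>S. \<forall>l\<in>N. q l z \<le> 0} = S \<inter> (\<Inter>l\<in>N. {z\<in>S. q l z \<le> 0})" by auto
  show ?thesis unfolding eq
    using assms by (intro convex_Int convex_INT convex_sublevel) auto
qed

text \<open>Multipliers of the constraint \<open>q \<le> 0\<close> lie between the slopes \<open>(m - G z) / q z\<close>
  with \<open>q z > 0\<close> and those with \<open>q z < 0\<close>.\<close>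

lemma slope_le:
  assumes G: "convex_on S G" and q: "convex_on S q"
    and z: "z \<in> S" "q z > 0" and z': "z' \<in> S" "q z' < 0"
    and m: "\<And>t. 0 \<le> t \<Longrightarrow> t \<le> 1 \<Longrightarrow> t * q z' + (1 - t) * q z = 0 \<Longrightarrow>
      m \<le> G ((1 - t) *\<^sub>R z + t *\<^sub>R z')"
  shows "(m - G z) / q z \<le> (m - G z') / (q z' :: real)"
proof -
  \<comment> \<open>The weight at which the chord of \<open>q\<close> between \<open>z\<close> and
    \<open>z'\<close> vanishes. The premise \<open>m\<close> speaks of the chord so that it fits
    both uses: at that point a convex \<open>q\<close> is at most zero, an affine \<open>q\<close>
    is zero.\<close>
  define t where "t = q z / (q z - q z')"
  have d: "q z - q z' > 0" using z z' by auto
  have t: "0 \<le> t" "t \<le> 1" using z z' d by (auto simp: t_def field_simps)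
  have t1: "1 - t = - q z' / (q z - q z')" using d by (simp add: t_def field_simps)
  have "t * q z' + (1 - t) * q z = 0" using d unfolding t1 by (simp add: t_def field_simps)
  then have "m \<le> G ((1 - t) *\<^sub>R z + t *\<^sub>R z')" using m t by blast
  also have "\<dots> \<le> (1 - t) * G z + t * G z'" using convex_onD[OF G] t z z' by blast
  also have "\<dots> = (- q z' * G z + q z * G z') / (q z - q z')"
    unfolding t1 by (simp add: t_def diff_divide_distrib)
  finally have "m * (q z - q z') \<le> - q z' * G z + q z * G z'"
    using d by (simp add: field_simps)
  then have "(m - G z') * q z \<le> (m - G z) * q z'" by (simp add: algebra_simps)
  then show ?thesis
    using z z' by (simp add: field_simps)
qed

text \<open>The supremum of the slopes with \<open>q z > 0\<close> serves as the multiplier; by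
  \<open>slope_le\<close> no slope with \<open>q z < 0\<close> lies below it. The strict point
  \<open>z1\<close> shows that the supremum is finite.\<close>

lemma inequality_multiplier:
  assumes G: "convex_on S G" and q: "convex_on S q"
    and z1: "z1 \<in> S" "q z1 < 0"
    and m: "\<And>z. z \<in> S \<Longrightarrow> q z \<le> 0 \<Longrightarrow> m \<le> G z"
  shows "\<exists>\<mu>\<ge>0. \<forall>z\<in>S. m \<le> G z + \<mu> * (q z :: real)"
proof -
  have S: "convex S" using convex_on_imp_convex[OF G] .
  have sl: "(m - G z) / q z \<le> (m - G z') / q z'"
    if "z \<in> S" "q z > 0" "z' \<in> S" "q z' < 0" for z z'
  proof (rule slope_le[OF G q that])
    fix t :: real assume t: "0 \<le> t" "t \<le> 1" "t * q z' + (1 - t) * q z = 0"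
    have "q ((1 - t) *\<^sub>R z + t *\<^sub>R z') \<le> 0"
      using convex_onD[OF q t(1,2) that(1,3)] t(3) by simp
    then show "m \<le> G ((1 - t) *\<^sub>R z + t *\<^sub>R z')"
      using S that t by (intro m) (auto simp: convex_alt)
  qed
  \<comment> \<open>Inserting 0 makes the supremum nonnegative. It respects the upper bounds: where
    \<open>q z' < 0\<close> the point is feasible, so \<open>m \<le> G z'\<close> and the slope
    there is nonnegative.\<close>
  define A where "A = insert 0 ((\<lambda>z. (m - G z) / q z) ` {z\<in>S. q z > 0})"
  have le: "x \<le> (m - G z') / q z'" if "x \<in> A" "z' \<in> S" "q z' < 0" for x z'
    using that sl m[of z'] by (auto simp: A_def divide_nonpos_neg)
  have bdd: "bdd_above A" using le[OF _ z1] by (auto simp: bdd_above_def)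
  show ?thesis
  proof (intro exI conjI ballI)
    show "0 \<le> Sup A" using bdd by (intro cSup_upper) (auto simp: A_def)
    fix z assume z: "z \<in> S"
    consider "q z = 0" | "q z > 0" | "q z < 0" by linarith
    then show "m \<le> G z + Sup A * q z"
    proof cases
      case 1 then show ?thesis using m z by simp
    next
      case 2
      have "(m - G z) / q z \<le> Sup A" using bdd z 2 by (intro cSup_upper) (auto simp: A_def)
      then show ?thesis using 2 by (simp add: field_simps)
    next
      case 3
      have "Sup A \<le> (m - G z) / q z" using le z 3 by (intro cSup_least) (auto simp: A_def)
      then show ?thesis using 3 by (simp add: field_simps)
    qed
  qed
qed

text \<open>The multiplier of \<open>q j\<close> is found on the set cut out by the other
  constraints, which still contains \<open>z0\<close>; then \<open>G + \<mu> * q j\<close> takes the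
  place of \<open>G\<close>, hence the induction over arbitrary \<open>G\<close>.\<close>

lemma strict_inequality_multipliers:
  assumes "finite N" and "convex_on S G" and "\<And>l. l \<in> N \<Longrightarrow> convex_on S (q l)"
    and "z0 \<in> S" and "\<And>l. l \<in> N \<Longrightarrow> q l z0 < 0"
    and "\<And>z. z \<in> S \<Longrightarrow> \<forall>l\<in>N. q l z \<le> 0 \<Longrightarrow> m \<le> G z"
  shows "\<exists>\<nu>. (\<forall>l\<in>N. \<nu> l \<ge> 0) \<and> (\<forall>z\<in>S. m \<le> G z + (\<Sum>l\<in>N. \<nu> l * (q l z :: real)))"
  using assms
proof (induction N arbitrary: G rule: finite_induct)
  case empty
  then show ?case by auto
next
  case (insert j N)
  let ?S' = "{z\<in>S. \<forall>l\<in>N. q l z \<le> 0}"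
  have S: "convex S" using convex_on_imp_convex[OF insert.prems(1)] .
  have S': "convex ?S'" using S insert.prems(2) by (intro convex_constraints) auto
  have z0: "z0 \<in> ?S'" using insert.prems(3,4) by (auto simp: less_imp_le)
  have G': "convex_on ?S' G" by (rule convex_on_subset[OF insert.prems(1) _ S']) auto
  have q': "convex_on ?S' (q j)"
    by (rule convex_on_subset[OF insert.prems(2)[OF insertI1] _ S']) auto
  have "m \<le> G z" if "z \<in> ?S'" "q j z \<le> 0" for z
    using that insert.prems(5)[of z] by auto
  from inequality_multiplier[OF G' q' z0 insert.prems(4)[OF insertI1] this]
  obtain \<mu> where mu: "\<mu> \<ge> 0" "\<forall>z\<in>?S'. m \<le> G z + \<mu> * q j z" by blast
  have "convex_on S (\<lambda>z. G z + \<mu> * q j z)"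
    by (intro convex_on_add convex_on_cmul mu(1) insert.prems(1) insert.prems(2)[OF insertI1])
  from insert.IH[OF this insert.prems(2)[OF insertI2] insert.prems(3) insert.prems(4)[OF insertI2]] mu(2)
  have "\<exists>\<nu>. (\<forall>l\<in>N. \<nu> l \<ge> 0) \<and> (\<forall>z\<in>S. m \<le> (G z + \<mu> * q j z) + (\<Sum>l\<in>N. \<nu> l * q l z))"
    by blast
  then obtain \<nu> where nu: "\<forall>l\<in>N. \<nu> l \<ge> 0"
    "\<forall>z\<in>S. m \<le> (G z + \<mu> * q j z) + (\<Sum>l\<in>N. \<nu> l * q l z)" by blast
  have "(\<Sum>l\<in>N. (\<nu>(j := \<mu>)) l * q l z) = (\<Sum>l\<in>N. \<nu> l * q l z)" for z
    using insert.hyps by (intro sum.cong) auto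
  then show ?case
    using insert.hyps mu(1) nu by (intro exI[of _ "\<nu>(j := \<mu>)"]) (auto simp: add.assoc)
qed

section \<open>Relative interior points, equality constraints and affine inequalities\<close>

lemma rel_interior_prolong:
  fixes z0 :: "'a::euclidean_space"
  assumes "convex S" "z0 \<in> rel_interior S" "x \<in> S"
  obtains e where "e > 0" "z0 + e *\<^sub>R (z0 - x) \<in> S"
proof -
  have "S \<noteq> {}" using assms(3) by auto
  then obtain e where "e > 1" "(1 - e) *\<^sub>R x + e *\<^sub>R z0 \<in> S"
    using assms convex_rel_interior_iff[of S z0] by blast
  then show ?thesis using that[of "e - 1"] by (simp add: algebra_simps)
qed

text \<open>If the linear function were larger at \<open>x\<close>, prolonging the segment from
  \<open>x\<close> through \<open>z0\<close> inside \<open>S\<close> would take it below its value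
  at \<open>z0\<close>.\<close>

lemma affine_min_rel_interior:
  fixes z0 :: "'a::euclidean_space"
  assumes S: "convex S" "z0 \<in> rel_interior S" and x: "x \<in> S"
    and le: "\<And>z. z \<in> S \<Longrightarrow> a \<bullet> z0 \<le> a \<bullet> z"
  shows "a \<bullet> x = a \<bullet> z0"
proof -
  obtain e where e: "e > 0" "z0 + e *\<^sub>R (z0 - x) \<in> S" using rel_interior_prolong[OF S x] .
  from le[OF e(2)] e(1) have "a \<bullet> x \<le> a \<bullet> z0"
    by (simp add: inner_add_right inner_diff_right zero_le_mult_iff)
  then show ?thesis using le[OF x] by simp
qed

text \<open>The multiplier may have either sign, so slopes must bound it from both sides. If
  \<open>S\<close> is not contained in the hyperplane, a point of \<open>S\<close> off it and its
  prolongation through the relative interior point \<open>z0\<close> lie on opposite sides and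
  supply slopes of both kinds.\<close>

lemma equality_multiplier:
  fixes a :: "'a::euclidean_space"
  assumes G: "convex_on S G"
    and z0: "z0 \<in> rel_interior S" "a \<bullet> z0 + b = 0"
    and m: "\<And>z. z \<in> S \<Longrightarrow> a \<bullet> z + b = 0 \<Longrightarrow> m \<le> G z"
  shows "\<exists>\<mu>. \<forall>z\<in>S. m \<le> G z + \<mu> * (a \<bullet> z + b)"
proof -
  have S: "convex S" using convex_on_imp_convex[OF G] .
  let ?q = "\<lambda>z. a \<bullet> z + b"
  have q: "convex_on S ?q" using S by (rule convex_on_affine_fun)
  show ?thesis
  proof (cases "\<forall>z\<in>S. ?q z = 0")
    case True
    then show ?thesis using m by auto
  next
    case False
    then obtain x where x: "x \<in> S" "?q x \<noteq> 0" by auto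
    obtain e where e: "e > 0" "z0 + e *\<^sub>R (z0 - x) \<in> S"
      using rel_interior_prolong[OF S z0(1) x(1)] .
    have "?q (z0 + e *\<^sub>R (z0 - x)) = (1 + e) * ?q z0 - e * ?q x" by (simp add: algebra_simps)
    then have qx: "?q (z0 + e *\<^sub>R (z0 - x)) = - e * ?q x" using z0 by simp
    obtain z1 z2 where z12: "z1 \<in> S" "z2 \<in> S" "?q z1 > 0" "?q z2 < 0"
    proof (cases "?q x > 0")
      case True
      then show ?thesis using that[of x "z0 + e *\<^sub>R (z0 - x)"] x e qx by (simp add: mult_pos_pos)
    next
      case False
      then have "- e * ?q x > 0" using e x(2) by (intro mult_neg_neg) auto
      then show ?thesis using that[of "z0 + e *\<^sub>R (z0 - x)" x] False x e qx by simp
    qed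
    have sl: "(m - G z) / ?q z \<le> (m - G z') / ?q z'"
      if "z \<in> S" "?q z > 0" "z' \<in> S" "?q z' < 0" for z z'
    proof (rule slope_le[OF G q that])
      fix t :: real assume t: "0 \<le> t" "t \<le> 1" "t * ?q z' + (1 - t) * ?q z = 0"
      have "?q ((1 - t) *\<^sub>R z + t *\<^sub>R z') = 0"
        using t(3) by (simp add: inner_add_right algebra_simps)
      then show "m \<le> G ((1 - t) *\<^sub>R z + t *\<^sub>R z')"
        using S that t by (intro m) (auto simp: convex_alt)
    qed
    define A where "A = (\<lambda>z. (m - G z) / ?q z) ` {z\<in>S. ?q z > 0}"
    have ne: "A \<noteq> {}" using z12 by (auto simp: A_def)
    have le: "r \<le> (m - G z') / ?q z'" if "r \<in> A" "z' \<in> S" "?q z' < 0" for r z'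
      using that sl by (auto simp: A_def)
    have bdd: "bdd_above A" using le z12 by (auto simp: bdd_above_def)
    show ?thesis
    proof (intro exI ballI)
      fix z assume z: "z \<in> S"
      consider "?q z = 0" | "?q z > 0" | "?q z < 0" by linarith
      then show "m \<le> G z + Sup A * ?q z"
      proof cases
        case 1 then show ?thesis using m z by simp
      next
        case 2
        have "(m - G z) / ?q z \<le> Sup A" using bdd z 2 by (intro cSup_upper) (auto simp: A_def)
        then show ?thesis using 2 by (simp add: pos_divide_le_eq)
      next
        case 3
        have "Sup A \<le> (m - G z) / ?q z" using le z 3 ne by (intro cSup_least) auto
        then show ?thesis using 3 by (simp add: neg_le_divide_eq)
      qed
    qed
  qed
qed

lemma affine_equalities: "affine {z. \<forall>k\<in>T. a k \<bullet> z + b k = (0::real)}"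
proof -
  have "affine {z. a k \<bullet> z + b k = 0}" for k
  proof -
    have "{z. a k \<bullet> z + b k = 0} = {z. a k \<bullet> z = - b k}" by auto
    then show ?thesis by (simp add: affine_hyperplane)
  qed
  moreover have "{z. \<forall>k\<in>T. a k \<bullet> z + b k = 0} = (\<Inter>k\<in>T. {z. a k \<bullet> z + b k = 0})" by auto
  ultimately show ?thesis by (metis (no_types, lifting) affine_Inter imageE)
qed

text \<open>Relative interior commutes with intersecting an affine set that meets the relative
  interior of \<open>S\<close>. This keeps \<open>z0\<close> usable when the ground set is cut down
  by equalities.\<close>

lemma rel_interior_equalities:
  fixes a :: "'i \<Rightarrow> 'a::euclidean_space"
  assumes "convex S" "z0 \<in> rel_interior S" "\<And>k. k \<in> T \<Longrightarrow> a k \<bullet> z0 + b k = 0"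
  shows "convex {z\<in>S. \<forall>k\<in>T. a k \<bullet> z + b k = 0}"
    and "z0 \<in> rel_interior {z\<in>S. \<forall>k\<in>T. a k \<bullet> z + b k = 0}"
proof -
  let ?E = "{z. \<forall>k\<in>T. a k \<bullet> z + b k = 0}"
  have eq: "{z\<in>S. \<forall>k\<in>T. a k \<bullet> z + b k = 0} = S \<inter> ?E" by auto
  show "convex {z\<in>S. \<forall>k\<in>T. a k \<bullet> z + b k = 0}"
    unfolding eq by (intro convex_Int assms(1) affine_imp_convex affine_equalities)
  have "z0 \<in> rel_interior S \<inter> ?E" using assms by auto
  then show "z0 \<in> rel_interior {z\<in>S. \<forall>k\<in>T. a k \<bullet> z + b k = 0}"
    using convex_affine_rel_interior_Int[OF assms(1) affine_equalities[of T a b]] unfolding eq by blast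
qed

lemma equality_multipliers:
  fixes a :: "'i \<Rightarrow> 'a::euclidean_space"
  assumes "finite T" and "convex_on S G" and "z0 \<in> rel_interior S"
    and "\<And>k. k \<in> T \<Longrightarrow> a k \<bullet> z0 + b k = 0"
    and "\<And>z. z \<in> S \<Longrightarrow> \<forall>k\<in>T. a k \<bullet> z + b k = 0 \<Longrightarrow> m \<le> G z"
  shows "\<exists>\<mu>. \<forall>z\<in>S. m \<le> G z + (\<Sum>k\<in>T. \<mu> k * (a k \<bullet> z + b k))"
  using assms
proof (induction T arbitrary: G rule: finite_induct)
  case empty
  then show ?case by auto
next
  case (insert j T)
  let ?S' = "{z\<in>S. \<forall>k\<in>T. a k \<bullet> z + b k = 0}"
  have S: "convex S" using convex_on_imp_convex[OF insert.prems(1)] .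
  note S' = rel_interior_equalities[OF S insert.prems(2), of T a b]
  have "convex_on ?S' G"
    using S'(1) insert.prems by (intro convex_on_subset[OF insert.prems(1)]) auto
  from equality_multiplier[OF this S'(2), of "a j" "b j" m] insert.prems
  obtain \<mu>0 where mu: "\<And>z. z \<in> ?S' \<Longrightarrow> m \<le> G z + \<mu>0 * (a j \<bullet> z + b j)" by auto
  have eq: "\<mu>0 * (a j \<bullet> z + b j) = (\<mu>0 *\<^sub>R a j) \<bullet> z + \<mu>0 * b j" for z
    by (simp add: distrib_left)
  have "convex_on S (\<lambda>z. G z + \<mu>0 * (a j \<bullet> z + b j))"
    unfolding eq using insert.prems S by (intro convex_on_add convex_on_affine_fun)
  from insert.IH[OF this] insert.prems mu
  obtain \<mu> where nu: "\<forall>z\<in>S. m \<le> (G z + \<mu>0 * (a j \<bullet> z + b j)) + (\<Sum>k\<in>T. \<mu> k * (a k \<bullet> z + b k))"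
    by auto
  have "(\<Sum>k\<in>T. (\<mu>(j := \<mu>0)) k * (a k \<bullet> z + b k)) = (\<Sum>k\<in>T. \<mu> k * (a k \<bullet> z + b k))" for z
    using insert.hyps by (intro sum.cong) auto
  then show ?case
    using insert.hyps nu by (intro exI[of _ "\<mu>(j := \<mu>0)"]) (auto simp: add.assoc)
qed

text \<open>Affine constraints need no strictly feasible point. Induction on their number: if \<open>q j\<close> cannot be
  made negative, the induction hypothesis for the objective \<open>q j\<close> yields a nonnegative combination
  \<open>q j + (\<Sum>k. \<lambda> k * q k)\<close> that vanishes on \<open>S\<close>. The constraints with \<open>\<lambda> k > 0\<close> then hold with
  equality, and a large multiple of that combination makes their multipliers nonnegative.\<close>

lemma affine_multipliers:
  fixes a :: "'i \<Rightarrow> 'a::euclidean_space"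
  assumes "finite K" and "convex_on S G" and "z0 \<in> rel_interior S"
    and "\<And>k. k \<in> K \<Longrightarrow> a k \<bullet> z0 + b k \<le> 0"
    and "\<And>z. z \<in> S \<Longrightarrow> \<forall>k\<in>K. a k \<bullet> z + b k \<le> 0 \<Longrightarrow> m \<le> G z"
  shows "\<exists>\<mu>. (\<forall>k\<in>K. 0 \<le> \<mu> k) \<and> (\<forall>z\<in>S. m \<le> G z + (\<Sum>k\<in>K. \<mu> k * (a k \<bullet> z + b k)))"
  using assms
\<comment> \<open>The hypothesis is applied to the objective \<open>q j\<close> with bound 0, and to
  \<open>K' - T\<close> over a smaller ground set; hence arbitrary \<open>S\<close>,
  \<open>G\<close>, \<open>m\<close> and all proper subsets.\<close>
proof (induction K arbitrary: S G m rule: finite_psubset_induct)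
  case (psubset K)
  note G = psubset.prems(1) and z0 = psubset.prems(2) and q0 = psubset.prems(3)
    and m = psubset.prems(4)
  have S: "convex S" using convex_on_imp_convex[OF G] .
  have z0S: "z0 \<in> S" using z0 rel_interior_subset by auto
  let ?q = "\<lambda>k z. a k \<bullet> z + b k"
  show ?case
  proof (cases "K = {}")
    case True
    then show ?thesis using m by auto
  next
    case False
    then obtain j where j: "j \<in> K" by auto
    define K' where "K' = K - {j}"
    have K: "K = insert j K'" "j \<notin> K'" "K' \<subset> K" "finite K'"
      using j psubset.hyps by (auto simp: K'_def)
    let ?S' = "{z\<in>S. \<forall>k\<in>K'. ?q k z \<le> 0}"
    have S': "convex ?S'" using S by (intro convex_constraints convex_on_affine_fun)
    show ?thesis
    proof (cases "\<exists>z1\<in>?S'. ?q j z1 < 0")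
      case True
      \<comment> \<open>A strict point for \<open>q j\<close> on the set cut out by the others
        allows \<open>inequality_multiplier\<close>; the induction hypothesis treats
        \<open>K'\<close> with the enlarged objective.\<close>
      then obtain z1 where z1: "z1 \<in> ?S'" "?q j z1 < 0" by blast
      have G': "convex_on ?S' G" by (rule convex_on_subset[OF G _ S']) auto
      have "m \<le> G z" if "z \<in> ?S'" "?q j z \<le> 0" for z
        using that m[of z] K(1) by auto
      from inequality_multiplier[OF G' convex_on_affine_fun[OF S'] z1 this]
      obtain \<mu>0 where mu0: "\<mu>0 \<ge> 0" "\<forall>z\<in>?S'. m \<le> G z + \<mu>0 * ?q j z" by blast
      have "convex_on S (\<lambda>z. G z + \<mu>0 * ?q j z)"
        by (intro convex_on_add convex_on_cmul mu0(1) G convex_on_affine_fun S)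
      from psubset.IH[OF K(3) this z0, of m] mu0(2) q0 K(1)
      have "\<exists>\<mu>. (\<forall>k\<in>K'. 0 \<le> \<mu> k) \<and> (\<forall>z\<in>S. m \<le> (G z + \<mu>0 * ?q j z) + (\<Sum>k\<in>K'. \<mu> k * ?q k z))"
        by blast
      then obtain \<mu> where mu: "\<forall>k\<in>K'. 0 \<le> \<mu> k"
        "\<forall>z\<in>S. m \<le> (G z + \<mu>0 * ?q j z) + (\<Sum>k\<in>K'. \<mu> k * ?q k z)" by blast
      have "(\<Sum>k\<in>K'. (\<mu>(j := \<mu>0)) k * ?q k z) = (\<Sum>k\<in>K'. \<mu> k * ?q k z)" for z
        using K by (intro sum.cong) auto
      then show ?thesis
        using mu0(1) mu K by (intro exI[of _ "\<mu>(j := \<mu>0)"]) (auto simp: add.assoc)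
    next
      case False
      then have ge: "\<And>z. z \<in> S \<Longrightarrow> \<forall>k\<in>K'. ?q k z \<le> 0 \<Longrightarrow> 0 \<le> ?q j z" by force
      have q0': "\<And>k. k \<in> K' \<Longrightarrow> ?q k z0 \<le> 0" using q0 K by auto
      from psubset.IH[OF K(3) convex_on_affine_fun[OF S] z0 q0' ge]
      obtain l where l: "\<forall>k\<in>K'. 0 \<le> l k" "\<forall>z\<in>S. 0 \<le> ?q j z + (\<Sum>k\<in>K'. l k * ?q k z)"
        by blast
      define w where "w = a j + (\<Sum>k\<in>K'. l k *\<^sub>R a k)"
      define s where "s = b j + (\<Sum>k\<in>K'. l k * b k)"
      have w: "?q j z + (\<Sum>k\<in>K'. l k * ?q k z) = w \<bullet> z + s" for z
        by (simp add: w_def s_def inner_add_left inner_sum_left distrib_left sum.distrib)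
      have terms: "l k * ?q k z0 \<le> 0" if "k \<in> K'" for k
        using l(1) q0' that by (simp add: mult_nonneg_nonpos)
      then have sum0: "(\<Sum>k\<in>K'. l k * ?q k z0) \<le> 0" by (intro sum_nonpos) auto
      have qj0: "?q j z0 \<le> 0" using q0 j by auto
      \<comment> \<open>At \<open>z0\<close> the combination is nonnegative and a sum of nonpositive
        terms, so it and each term vanish. Being affine and nonnegative on \<open>S\<close>, it is
        then zero on all of \<open>S\<close>.\<close>
      have w0: "w \<bullet> z0 + s = 0"
        using sum0 qj0 l(2) z0S w[of z0] by force
      have ws: "w \<bullet> z + s = 0" if "z \<in> S" for z
        using affine_min_rel_interior[OF S z0 that, of w] l(2) w w0 by fastforce
      have qj_eq: "?q j z0 = 0" and sum_eq: "(\<Sum>k\<in>K'. l k * ?q k z0) = 0"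
        using w0 w[of z0] sum0 qj0 by linarith+
      have "(\<Sum>k\<in>K'. - (l k * ?q k z0)) = 0" using sum_eq by (simp add: sum_negf)
      then have zero: "l k * ?q k z0 = 0" if "k \<in> K'" for k
        using that terms sum_nonneg_eq_0_iff[OF K(4), of "\<lambda>k. - (l k * ?q k z0)"] by auto
      define T where "T = {k\<in>K'. l k > 0}"
      have T: "finite T" "T \<subseteq> K'" using K(4) by (auto simp: T_def)
      have T0: "?q k z0 = 0" if "k \<in> T" for k using zero that by (fastforce simp: T_def)
      have lT: "(\<Sum>k\<in>K'. l k * ?q k z) = (\<Sum>k\<in>T. l k * ?q k z)" for z
        using T(2) K(4) l(1) by (intro sum.mono_neutral_right) (force simp: T_def)+
      let ?S1 = "{z\<in>S. \<forall>k\<in>T. ?q k z = 0}"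
      note S1 = rel_interior_equalities[OF S z0, of T a b, OF T0]
      have G1: "convex_on ?S1 G" by (rule convex_on_subset[OF G _ S1(1)]) auto
      have m1: "m \<le> G z" if "z \<in> ?S1" "\<forall>k\<in>K' - T. ?q k z \<le> 0" for z
      proof (rule m)
        have "?q j z = 0" using ws[of z] w[of z] lT[of z] that(1) by simp
        moreover have "?q k z \<le> 0" if "k \<in> K'" for k
          using \<open>z \<in> ?S1\<close> \<open>\<forall>k\<in>K' - T. ?q k z \<le> 0\<close> that by (cases "k \<in> T") auto
        ultimately show "\<forall>k\<in>K. ?q k z \<le> 0" unfolding K(1) by simp
        show "z \<in> S" using that by simp
      qed
      have sub: "K' - T \<subset> K" using K by auto
      have q01: "?q k z0 \<le> 0" if "k \<in> K' - T" for k using q0' that by auto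
      from psubset.IH[OF sub G1 S1(2) q01 m1]
      obtain \<kappa> where ka: "\<forall>k\<in>K'-T. 0 \<le> \<kappa> k"
        "\<forall>z\<in>?S1. m \<le> G z + (\<Sum>k\<in>K'-T. \<kappa> k * ?q k z)" by blast
      have "convex_on S (\<lambda>z. G z + (\<Sum>k\<in>K'-T. \<kappa> k * ?q k z))"
        using ka by (intro convex_on_add convex_on_sum_fun convex_on_cmul G convex_on_affine_fun S) auto
      moreover have "m \<le> G z + (\<Sum>k\<in>K'-T. \<kappa> k * ?q k z)" if "z \<in> S" "\<forall>k\<in>T. ?q k z = 0" for z
        using ka that by blast
      ultimately obtain \<mu> where mu:
        "\<forall>z\<in>S. m \<le> (G z + (\<Sum>k\<in>K'-T. \<kappa> k * ?q k z)) + (\<Sum>k\<in>T. \<mu> k * ?q k z)"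
        using equality_multipliers[OF T(1) _ z0, of "\<lambda>z. G z + (\<Sum>k\<in>K'-T. \<kappa> k * ?q k z)" a b m] T0
        by blast
      \<comment> \<open>A sum in place of the maximum of the quotients, which also covers an empty
        \<open>T\<close>. Adding \<open>t\<close> times the vanishing combination contributes
        \<open>t\<close> to the coefficient of \<open>q j\<close> and \<open>t * l k\<close> to that
        of \<open>q k\<close> for \<open>k\<close> in \<open>T\<close>.\<close>
      define t where "t = (\<Sum>k\<in>T. \<bar>\<mu> k\<bar> / l k)"
      have t0: "t \<ge> 0" unfolding t_def by (intro sum_nonneg) (auto simp: T_def)
      have tk: "0 \<le> \<mu> k + t * l k" if "k \<in> T" for k
      proof -
        have "\<bar>\<mu> k\<bar> / l k \<le> t"
          unfolding t_def using that T(1) by (intro member_le_sum) (auto simp: T_def)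
        moreover have "l k > 0" using that by (simp add: T_def)
        ultimately show ?thesis by (simp add: field_simps)
      qed
      define \<theta> where "\<theta> k = (if k = j then t else if k \<in> T then \<mu> k + t * l k else \<kappa> k)" for k
      have "m \<le> G z + (\<Sum>k\<in>K. \<theta> k * ?q k z)" if "z \<in> S" for z
      proof -
        have jT: "j \<notin> T" using T K by auto
        have "(\<Sum>k\<in>K. \<theta> k * ?q k z) = t * ?q j z + (\<Sum>k\<in>K'. \<theta> k * ?q k z)"
          using K by (simp add: \<theta>_def)
        also have "(\<Sum>k\<in>K'. \<theta> k * ?q k z) = (\<Sum>k\<in>K'-T. \<theta> k * ?q k z) + (\<Sum>k\<in>T. \<theta> k * ?q k z)"
          using K(4) T(2) by (rule sum.subset_diff[rotated])
        also have "(\<Sum>k\<in>K'-T. \<theta> k * ?q k z) = (\<Sum>k\<in>K'-T. \<kappa> k * ?q k z)"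
          using K by (intro sum.cong) (auto simp: \<theta>_def)
        also have "(\<Sum>k\<in>T. \<theta> k * ?q k z) = (\<Sum>k\<in>T. \<mu> k * ?q k z + t * (l k * ?q k z))"
          using jT by (intro sum.cong) (auto simp: \<theta>_def algebra_simps)
        also have "\<dots> = (\<Sum>k\<in>T. \<mu> k * ?q k z) + t * (\<Sum>k\<in>T. l k * ?q k z)"
          by (simp only: sum.distrib sum_distrib_left)
        finally have "(\<Sum>k\<in>K. \<theta> k * ?q k z) = t * (?q j z + (\<Sum>k\<in>T. l k * ?q k z))
          + ((\<Sum>k\<in>K'-T. \<kappa> k * ?q k z) + (\<Sum>k\<in>T. \<mu> k * ?q k z))"
          by (simp only: distrib_left add_ac)
        also have "?q j z + (\<Sum>k\<in>T. l k * ?q k z) = 0"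
          using ws[OF that] w[of z] lT[of z] by linarith
        finally show ?thesis using mu that by (simp add: add_ac)
      qed
      moreover have "\<forall>k\<in>K. 0 \<le> \<theta> k"
        using t0 tk ka K by (auto simp: \<theta>_def)
      ultimately show ?thesis by blast
    qed
  qed
qed

section \<open>Splitting a sum of convex functions\<close>

text \<open>Fenchel duality with an attained dual solution: an affine minorant replaces
  \<open>\<psi>\<close> without losing the bound \<open>m\<close>. The \<open>s\<close> constructed
  is the conjugate of \<open>\<psi>\<close> on \<open>D\<close> at \<open>y\<close>. The common
  relative interior point makes the separating hyperplane nonvertical.\<close>

lemma convex_on_split:
  fixes S D :: "'a::euclidean_space set"
  assumes G: "convex_on S G" and \<psi>: "convex_on D \<psi>"
    and z0S: "z0 \<in> rel_interior S" and z0D: "z0 \<in> rel_interior D"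
    and m: "\<And>z. z \<in> S \<Longrightarrow> z \<in> D \<Longrightarrow> m \<le> G z + \<psi> z"
  shows "\<exists>y s. (\<forall>z\<in>D. y \<bullet> z - \<psi> z \<le> s) \<and> (\<forall>z\<in>S. m \<le> G z + (y \<bullet> z - s))"
proof -
  have S: "convex S" and D: "convex D" using G \<psi> convex_on_imp_convex by auto
  have z0: "z0 \<in> S" "z0 \<in> D" using z0S z0D rel_interior_subset by auto
  \<comment> \<open>The arguments of the two functions are moved apart by \<open>z - w\<close>, and
    \<open>r\<close> lies strictly above the sum minus \<open>m\<close>. The origin in
    \<open>Q\<close> would be a common point with value below \<open>m\<close>.\<close>
  define Q where "Q = {(z - w, r) | z w r. z \<in> D \<and> w \<in> S \<and> \<psi> z + G w - m < r}"
  have QI: "(z - w, r) \<in> Q" if "z \<in> D" "w \<in> S" "\<psi> z + G w - m < r" for z w r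
    using that unfolding Q_def by blast
  have "convex Q"
  proof (rule convexI)
    fix p p' :: "'a \<times> real" and u v :: real
    assume "p \<in> Q" "p' \<in> Q" and uv: "0 \<le> u" "0 \<le> v" "u + v = 1"
    then obtain z w r z' w' r' where p: "p = (z - w, r)" "p' = (z' - w', r')"
      "z \<in> D" "w \<in> S" "\<psi> z + G w - m < r" "z' \<in> D" "w' \<in> S" "\<psi> z' + G w' - m < r'"
      unfolding Q_def by blast
    have G\<psi>: "G (u *\<^sub>R w + v *\<^sub>R w') \<le> u * G w + v * G w'"
      "\<psi> (u *\<^sub>R z + v *\<^sub>R z') \<le> u * \<psi> z + v * \<psi> z'"
      using G \<psi> p uv by (auto simp: convex_on_def)
    have "\<psi> (u *\<^sub>R z + v *\<^sub>R z') + G (u *\<^sub>R w + v *\<^sub>R w') - m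
        \<le> (u * \<psi> z + v * \<psi> z') + (u * G w + v * G w') - (u + v) * m"
      unfolding uv(3) using G\<psi> by simp
    also have "\<dots> = u * (\<psi> z + G w - m) + v * (\<psi> z' + G w' - m)" by (simp add: algebra_simps)
    also have "\<dots> < u * r + v * r'"
    proof (cases "u = 0")
      case True
      then show ?thesis using uv p by simp
    next
      case False
      then have "u * (\<psi> z + G w - m) < u * r" using uv p by simp
      moreover have "v * (\<psi> z' + G w' - m) \<le> v * r'" using uv p by (intro mult_left_mono) auto
      ultimately show ?thesis by linarith
    qed
    finally have lt: "\<psi> (u *\<^sub>R z + v *\<^sub>R z') + G (u *\<^sub>R w + v *\<^sub>R w') - m < u * r + v * r'" .
    have "u *\<^sub>R p + v *\<^sub>R p' = ((u *\<^sub>R z + v *\<^sub>R z') - (u *\<^sub>R w + v *\<^sub>R w'), u * r + v * r')"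
      by (simp add: p algebra_simps)
    also have "\<dots> \<in> Q" using lt p uv S D by (intro QI) (auto simp: convexD)
    finally show "u *\<^sub>R p + v *\<^sub>R p' \<in> Q" .
  qed
  moreover have "Q \<noteq> {}" using QI[OF z0(2,1), of "\<psi> z0 + G z0 - m + 1"] by auto
  moreover have "0 \<notin> Q"
  proof
    assume "0 \<in> Q"
    then obtain z r where "z \<in> D" "z \<in> S" "\<psi> z + G z - m < 0"
      unfolding Q_def zero_prod_def by auto
    then show False using m[of z] by simp
  qed
  ultimately obtain p where p: "p \<in> span Q" "p \<noteq> 0" "\<And>x. x \<in> Q \<Longrightarrow> 0 \<le> p \<bullet> x"
    using separating_hyperplane_set_0_inspan by blast
  obtain v \<mu> where pv: "p = (v, \<mu>)" by (cases p)
  have sep: "0 \<le> v \<bullet> (z - w) + \<mu> * r" if "z \<in> D" "w \<in> S" "\<psi> z + G w - m < r" for z w r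
    using p(3)[OF QI[OF that]] by (simp add: pv)
  have "\<mu> \<ge> 0"
  proof (rule ccontr)
    assume "\<not> \<mu> \<ge> 0"
    moreover have "0 \<le> \<mu> * (\<bar>\<psi> z0 + G z0 - m\<bar> + 1)"
      using sep[OF z0(2,1), of "\<bar>\<psi> z0 + G z0 - m\<bar> + 1"] by simp
    ultimately show False by (simp add: zero_le_mult_iff)
  qed
  \<comment> \<open>A vertical hyperplane would make \<open>v\<close> constant on \<open>D\<close>
    and on \<open>S\<close>, with the value at \<open>z0\<close> on both. Then \<open>p\<close> is
    orthogonal to \<open>Q\<close> and, lying in its span, zero.\<close>
  moreover have "\<mu> \<noteq> 0"
  proof
    assume "\<mu> = 0"
    then have le: "v \<bullet> w \<le> v \<bullet> z" if "z \<in> D" "w \<in> S" for z w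
      using sep[OF that, of "\<psi> z + G w - m + 1"] by (simp add: inner_diff_right)
    have "v \<bullet> z = v \<bullet> z0" if "z \<in> D" for z
      using affine_min_rel_interior[OF D z0D that] le[OF _ z0(1)] by blast
    moreover have "(- v) \<bullet> w = (- v) \<bullet> z0" if "w \<in> S" for w
      using affine_min_rel_interior[OF S z0S that, of "- v"] le[OF z0(2)] by simp
    ultimately have "p \<bullet> x = 0" if "x \<in> Q" for x
      using that unfolding Q_def pv \<open>\<mu> = 0\<close> by (auto simp: inner_diff_right)
    then have "p \<bullet> p = 0" using orthogonal_to_span[OF p(1), of p] by (simp add: orthogonal_def)
    then show False using p(2) by simp
  qed
  ultimately have mu: "\<mu> > 0" by simp
  define y where "y = - (v /\<^sub>R \<mu>)"
  have vy: "v = - (\<mu> *\<^sub>R y)" using mu by (simp add: y_def)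
  have key: "y \<bullet> z - \<psi> z \<le> G w + y \<bullet> w - m" if "z \<in> D" "w \<in> S" for z w
  proof (rule field_le_epsilon)
    fix e :: real assume e: "e > 0"
    have "0 \<le> v \<bullet> (z - w) + \<mu> * (\<psi> z + G w - m + e)" using sep[OF that] e by simp
    also have "\<dots> = \<mu> * (\<psi> z + G w - m + e - y \<bullet> (z - w))"
      unfolding vy by (simp add: algebra_simps)
    finally have "0 \<le> \<psi> z + G w - m + e - y \<bullet> (z - w)" using mu by (simp add: zero_le_mult_iff)
    then show "y \<bullet> z - \<psi> z \<le> G w + y \<bullet> w - m + e" by (simp add: inner_diff_right)
  qed
  define s where "s = (SUP z\<in>D. y \<bullet> z - \<psi> z)"
  have "bdd_above ((\<lambda>z. y \<bullet> z - \<psi> z) ` D)" using key z0(1) by (auto simp: bdd_above_def)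
  then have "y \<bullet> z - \<psi> z \<le> s" if "z \<in> D" for z
    unfolding s_def using that by (rule cSUP_upper[rotated])
  moreover have "m \<le> G w + (y \<bullet> w - s)" if "w \<in> S" for w
  proof -
    have "s \<le> G w + y \<bullet> w - m" unfolding s_def using z0(2) key that by (intro cSUP_least) auto
    then show ?thesis by simp
  qed
  ultimately show ?thesis by blast
qed

lemma rel_interior_INT:
  fixes D :: "'i \<Rightarrow> 'a::euclidean_space set"
  assumes "finite N" "\<And>l. l \<in> N \<Longrightarrow> convex (D l)" "\<And>l. l \<in> N \<Longrightarrow> z0 \<in> rel_interior (D l)"
  shows "z0 \<in> rel_interior (\<Inter>l\<in>N. D l)"
proof -
  have z0: "z0 \<in> \<Inter> (rel_interior ` D ` N)" using assms(3) by auto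
  have "rel_interior (\<Inter> (D ` N)) = \<Inter> (rel_interior ` D ` N)"
  proof (rule convex_rel_interior_finite_Inter)
    show "\<Inter> (rel_interior ` D ` N) \<noteq> {}" using z0 by blast
  qed (use assms in auto)
  then show ?thesis using z0 by simp
qed

text \<open>One \<open>\<psi> j\<close> is split off at a time, against the rest on the intersection
  of the remaining domains. Its affine minorant joins \<open>g\<close>, which stays finite and
  convex on the whole space, so no domain restriction is left at the end.\<close>

lemma convex_on_split_sum:
  fixes D :: "'i \<Rightarrow> 'a::euclidean_space set"
  assumes "finite N" and "convex_on UNIV g" and "\<And>l. l \<in> N \<Longrightarrow> convex_on (D l) (\<psi> l)"
    and "\<And>l. l \<in> N \<Longrightarrow> z0 \<in> rel_interior (D l)"
    and "\<And>z. \<forall>l\<in>N. z \<in> D l \<Longrightarrow> m \<le> g z + (\<Sum>l\<in>N. \<psi> l z)"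
  shows "\<exists>y s. (\<forall>l\<in>N. \<forall>z\<in>D l. y l \<bullet> z - \<psi> l z \<le> s l) \<and>
    (\<forall>z. m \<le> g z + (\<Sum>l\<in>N. y l \<bullet> z - s l))"
  using assms
proof (induction N arbitrary: g rule: finite_induct)
  case empty
  then show ?case by auto
next
  case (insert j N)
  let ?S = "\<Inter>l\<in>N. D l"
  have cD: "convex (D l)" if "l \<in> N" for l
    using insert.prems(2)[of l] that convex_on_imp_convex by blast
  have S: "convex ?S" using cD by (rule convex_INT)
  have "z0 \<in> rel_interior ?S"
    using insert.hyps(1) cD insert.prems(3) by (intro rel_interior_INT) auto
  moreover have "convex_on ?S (\<lambda>z. g z + (\<Sum>l\<in>N. \<psi> l z))"
    using insert.prems(1,2) S
    by (intro convex_on_add convex_on_sum_fun) (auto intro: convex_on_subset)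
  ultimately have "\<exists>y s. (\<forall>z\<in>D j. y \<bullet> z - \<psi> j z \<le> s) \<and>
      (\<forall>z\<in>?S. m \<le> (g z + (\<Sum>l\<in>N. \<psi> l z)) + (y \<bullet> z - s))"
    using insert.prems(2-4) insert.hyps
    by (intro convex_on_split[of ?S _ "D j" "\<psi> j" z0 m]) (auto simp: add_ac)
  then obtain y0 s0 where y0: "\<forall>z\<in>D j. y0 \<bullet> z - \<psi> j z \<le> s0"
    "\<forall>z\<in>?S. m \<le> (g z + (\<Sum>l\<in>N. \<psi> l z)) + (y0 \<bullet> z - s0)" by blast
  have "convex_on UNIV (\<lambda>z. g z + (y0 \<bullet> z + - s0))"
    by (intro convex_on_add insert.prems(1) convex_on_affine_fun) simp
  moreover have "m \<le> (g z + (y0 \<bullet> z + - s0)) + (\<Sum>l\<in>N. \<psi> l z)" if "\<forall>l\<in>N. z \<in> D l" for z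
    using y0(2) that by (auto simp: algebra_simps)
  ultimately have "\<exists>y s. (\<forall>l\<in>N. \<forall>z\<in>D l. y l \<bullet> z - \<psi> l z \<le> s l) \<and>
    (\<forall>z. m \<le> (g z + (y0 \<bullet> z + - s0)) + (\<Sum>l\<in>N. y l \<bullet> z - s l))"
    using insert.prems(2,3) by (intro insert.IH) auto
  then obtain y s where ys: "\<forall>l\<in>N. \<forall>z\<in>D l. y l \<bullet> z - \<psi> l z \<le> s l"
    "\<forall>z. m \<le> (g z + (y0 \<bullet> z + - s0)) + (\<Sum>l\<in>N. y l \<bullet> z - s l)" by blast
  have "(\<Sum>l\<in>N. (y(j := y0)) l \<bullet> z - (s(j := s0)) l) = (\<Sum>l\<in>N. y l \<bullet> z - s l)" for z
    using insert.hyps by (intro sum.cong) auto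
  then show ?case
    using insert.hyps y0(1) ys
    by (intro exI[of _ "y(j := y0)"] exI[of _ "s(j := s0)"]) (auto simp: algebra_simps)
qed

section \<open>Conjugates of extended real-valued convex functions\<close>

lemma closed_epigraph:
  assumes "lsc_fun c"
  shows "closed {(x, r::real). c x \<le> ereal r}"
proof -
  have "open {(x, r::real). ereal r < c x}"
  proof (subst open_subopen, intro ballI)
    fix p assume "p \<in> {(x, r::real). ereal r < c x}"
    then obtain x r where p: "p = (x, r)" "ereal r < c x" by auto
    obtain s where s: "r < s" "ereal s < c x"
      using ereal_dense2[OF p(2)] by auto
    have "c x \<le> Liminf (at x) c" using assms by (simp add: lsc_fun_def)
    then have "\<forall>\<^sub>F y in at x. ereal s < c y" using s(2) by (intro less_LiminfD) auto
    \<comment> \<open>The limit inferior ignores \<open>x\<close> itself; there the bound holds by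
      the choice of \<open>s\<close>.\<close>
    then have "\<forall>\<^sub>F y in nhds x. ereal s < c y" using s(2) by (auto simp: eventually_at_filter elim: eventually_mono)
    then obtain U where U: "open U" "x \<in> U" "\<And>y. y \<in> U \<Longrightarrow> ereal s < c y"
      by (auto simp: eventually_nhds)
    have "U \<times> {..<s} \<subseteq> {(x, r). ereal r < c x}"
      using U(3) by (force intro: less_trans[of "ereal _" "ereal s"])
    then show "\<exists>T. open T \<and> p \<in> T \<and> T \<subseteq> {(x, r). ereal r < c x}"
      using U s p by (intro exI[of _ "U \<times> {..<s}"]) (auto simp: open_Times)
  qed
  moreover have "- {(x, r::real). c x \<le> ereal r} = {(x, r). ereal r < c x}" by auto
  ultimately show ?thesis by (simp add: closed_def)
qed

lemma proper_closed_convexD: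
  assumes "proper_closed_convex c"
  shows "c x \<noteq> -\<infinity>" and "\<exists>x. c x < \<infinity>" and "lsc_fun c" and "convex_fun c"
  using assms by (auto simp: proper_closed_convex_def proper_fun_def closed_fun_def edom_def)

lemma edom_ereal:
  assumes "proper_closed_convex c" "x \<in> edom c"
  shows "c x = ereal (real_of_ereal (c x))"
  using assms proper_closed_convexD(1)[OF assms(1), of x] by (cases "c x") (auto simp: edom_def)

lemma ereal_le_fun_iff:
  assumes "proper_closed_convex c"
  shows "(ereal r \<le> c x) \<longleftrightarrow> (\<forall>s. c x \<le> ereal s \<longrightarrow> r \<le> s)"
  using proper_closed_convexD(1)[OF assms, of x] by (cases "c x") auto

text \<open>The point \<open>(z, r)\<close> is strictly separated from the closed convex epigraph,
  and \<open>\<mu> \<ge> 0\<close> because the epigraph is unbounded upwards. The case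
  \<open>\<mu> = 0\<close> remains possible when \<open>c z\<close> is infinite.\<close>

lemma epigraph_separation:
  fixes c :: "'a::euclidean_space \<Rightarrow> ereal"
  assumes c: "proper_closed_convex c" and r: "ereal r < c z"
  shows "\<exists>v \<mu> t. \<mu> \<ge> 0 \<and> v \<bullet> z + \<mu> * r < t \<and> (\<forall>x s. c x \<le> ereal s \<longrightarrow> t < v \<bullet> x + \<mu> * s)"
proof -
  let ?E = "{(x, s::real). c x \<le> ereal s}"
  have "convex ?E" "closed ?E"
    using proper_closed_convexD[OF c] closed_epigraph by (auto simp: convex_fun_def)
  moreover have "(z, r) \<notin> ?E" using r by auto
  ultimately obtain p t where p: "p \<bullet> (z, r) < t" "\<forall>x\<in>?E. p \<bullet> x > t"
    using separating_hyperplane_closed_point[of ?E "(z, r)"] by blast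
  obtain v \<mu> where pv: "p = (v, \<mu>)" by (cases p)
  have E: "t < v \<bullet> x + \<mu> * s" if "c x \<le> ereal s" for x s
    using p(2) that unfolding pv by auto
  obtain x0 where x0: "c x0 < \<infinity>" using proper_closed_convexD(2)[OF c] by blast
  then obtain s0 where s0: "c x0 = ereal s0"
    using edom_ereal[OF c] by (auto simp: edom_def)
  have "\<mu> \<ge> 0"
  proof (rule ccontr)
    assume neg: "\<not> \<mu> \<ge> 0"
    \<comment> \<open>A height above \<open>x0\<close> at which a negative \<open>\<mu>\<close>
      would bring the functional down to \<open>t\<close>.\<close>
    define s where "s = max s0 ((t - v \<bullet> x0) / \<mu>)"
    have "t < v \<bullet> x0 + \<mu> * s" using s0 by (intro E) (auto simp: s_def)
    moreover have "\<mu> * s \<le> \<mu> * ((t - v \<bullet> x0) / \<mu>)" using neg by (intro mult_left_mono_neg) (auto simp: s_def)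
    ultimately show False using neg by simp
  qed
  then show ?thesis using p(1) E unfolding pv by auto
qed

lemma affine_minorant_nonvertical:
  fixes c :: "'a::euclidean_space \<Rightarrow> ereal"
  assumes c: "proper_closed_convex c" and mu: "\<mu> > 0"
    and z: "v \<bullet> z + \<mu> * r < t" and le: "\<forall>x s. c x \<le> ereal s \<longrightarrow> t < v \<bullet> x + \<mu> * s"
  shows "\<exists>a b. (\<forall>w. ereal (a \<bullet> w + b) \<le> c w) \<and> r < a \<bullet> z + b"
proof (intro exI conjI allI)
  have eq: "(- (v /\<^sub>R \<mu>)) \<bullet> w + t / \<mu> = (t - v \<bullet> w) / \<mu>" for w
    using mu by (simp add: field_simps)
  show "ereal ((- (v /\<^sub>R \<mu>)) \<bullet> w + t / \<mu>) \<le> c w" for w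
    unfolding eq ereal_le_fun_iff[OF c] using le mu by (force simp: field_simps)
  show "r < (- (v /\<^sub>R \<mu>)) \<bullet> z + t / \<mu>" unfolding eq using z mu by (simp add: field_simps)
qed

text \<open>A vertical separating hyperplane is tilted by adding a large multiple of it to a minorant
  that exists because the domain is nonempty.\<close>

lemma affine_minorant_above:
  fixes c :: "'a::euclidean_space \<Rightarrow> ereal"
  assumes c: "proper_closed_convex c" and r: "ereal r < c z"
  shows "\<exists>a b. (\<forall>w. ereal (a \<bullet> w + b) \<le> c w) \<and> r < a \<bullet> z + b"
proof -
  \<comment> \<open>Over a point of the domain the hyperplane cannot be vertical: it strictly
    separates \<open>(z, r)\<close> from the point of the epigraph with the same first
    component.\<close>
  have nonvert: "\<exists>a b. (\<forall>w. ereal (a \<bullet> w + b) \<le> c w) \<and> r < a \<bullet> z + b"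
    if r: "ereal r < c z" and z: "c z < \<infinity>" for r z
  proof -
    obtain v \<mu> t where *: "\<mu> \<ge> 0" "v \<bullet> z + \<mu> * r < t" "\<forall>x s. c x \<le> ereal s \<longrightarrow> t < v \<bullet> x + \<mu> * s"
      using epigraph_separation[OF c r] by blast
    obtain s where "c z = ereal s" using edom_ereal[OF c, of z] z by (auto simp: edom_def)
    then have "\<mu> \<noteq> 0" using *(2) *(3)[rule_format, of z s] by auto
    then show ?thesis using affine_minorant_nonvertical[OF c _ *(2,3)] *(1) by simp
  qed
  obtain v \<mu> t where *: "\<mu> \<ge> 0" "v \<bullet> z + \<mu> * r < t" "\<forall>x s. c x \<le> ereal s \<longrightarrow> t < v \<bullet> x + \<mu> * s"
    using epigraph_separation[OF c r] by blast
  show ?thesis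
  proof (cases "\<mu> = 0")
    case False
    then show ?thesis using affine_minorant_nonvertical[OF c _ *(2,3)] *(1) by simp
  next
    case True
    obtain x0 where x0: "c x0 < \<infinity>" using proper_closed_convexD(2)[OF c] by blast
    then obtain s0 where s0: "c x0 = ereal s0" using edom_ereal[OF c] by (auto simp: edom_def)
    obtain a b where ab: "\<And>w. ereal (a \<bullet> w + b) \<le> c w"
      using nonvert[of "s0 - 1" x0] s0 by auto
    define d where "d = t - v \<bullet> z"
    have d: "d > 0" using *(2) True by (simp add: d_def)
    \<comment> \<open>\<open>t - v \<bullet> w\<close> is positive at \<open>w = z\<close> and
      negative on the domain of \<open>c\<close>. So \<open>k\<close> times it leaves a minorant,
      and this \<open>k\<close> lifts its value at \<open>z\<close> above \<open>r\<close>.\<close>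
    define k where "k = (\<bar>r\<bar> + \<bar>a \<bullet> z + b\<bar> + 1) / d"
    have k: "k \<ge> 0" using d by (simp add: k_def)
    have kd: "k * (t - v \<bullet> z) = \<bar>r\<bar> + \<bar>a \<bullet> z + b\<bar> + 1" using d by (simp add: k_def flip: d_def)
    have eq: "(a - k *\<^sub>R v) \<bullet> w + (b + k * t) = (a \<bullet> w + b) + k * (t - v \<bullet> w)" for w
      by (simp add: algebra_simps)
    show ?thesis
    proof (intro exI conjI allI)
      show "ereal ((a - k *\<^sub>R v) \<bullet> w + (b + k * t)) \<le> c w" for w
        unfolding eq ereal_le_fun_iff[OF c]
      proof (intro allI impI)
        fix s assume s: "c w \<le> ereal s"
        have "a \<bullet> w + b \<le> s" using ab[of w] s by (metis ereal_less_eq(3) order_trans)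
        moreover have "t < v \<bullet> w" using *(3) s True by fastforce
        then have "k * (t - v \<bullet> w) \<le> 0" using k by (intro mult_nonneg_nonpos) auto
        ultimately show "a \<bullet> w + b + k * (t - v \<bullet> w) \<le> s" by linarith
      qed
      show "r < (a - k *\<^sub>R v) \<bullet> z + (b + k * t)" unfolding eq kd by linarith
    qed
  qed
qed

section \<open>Conjugates and perspectives\<close>

lemma conjugate_le:
  assumes "\<And>w. ereal (a \<bullet> w + b) \<le> c w"
  shows "conjugate c a \<le> ereal (- b)"
  unfolding conjugate_def
proof (rule SUP_least)
  fix x
  show "ereal (a \<bullet> x) - c x \<le> ereal (- b)" using assms[of x] by (cases "c x") auto
qed

text \<open>Where \<open>c\<close> is infinite, its affine minorants are arbitrarily large, and each
  lies below the biconjugate. This controls the perspective at \<open>\<nu> = 0\<close>, a support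
  function of the smaller set.\<close>

lemma edom_biconjugate_subset:
  fixes c :: "'a::euclidean_space \<Rightarrow> ereal"
  assumes c: "proper_closed_convex c"
  shows "edom (conjugate (conjugate c)) \<subseteq> edom c"
proof
  fix z assume "z \<in> edom (conjugate (conjugate c))"
  then have fin: "conjugate (conjugate c) z < \<infinity>" by (simp add: edom_def)
  show "z \<in> edom c"
  proof (rule ccontr)
    assume "z \<notin> edom c"
    then have inf: "c z = \<infinity>" by (simp add: edom_def)
    have "ereal r \<le> conjugate (conjugate c) z" for r
    proof -
      obtain a b where ab: "\<And>w. ereal (a \<bullet> w + b) \<le> c w" "r < a \<bullet> z + b"
        using affine_minorant_above[OF c, of r z] inf by auto
      have "ereal r \<le> ereal (z \<bullet> a) - ereal (- b)" using ab(2) by (simp add: inner_commute)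
      also have "\<dots> \<le> ereal (z \<bullet> a) - conjugate c a"
        using conjugate_le[of a b c] ab(1) by (intro ereal_minus_mono) auto
      also have "\<dots> \<le> conjugate (conjugate c) z"
        unfolding conjugate_def[of "conjugate c"] by (intro SUP_upper) auto
      finally show ?thesis .
    qed
    then have "conjugate (conjugate c) z = \<infinity>" by (simp add: ereal_top)
    then show False using fin by simp
  qed
qed

text \<open>For \<open>\<nu> > 0\<close> the perspective is the conjugate of
  \<open>\<nu> * c\<close>. At \<open>\<nu> = 0\<close> the premise bounds
  \<open>y \<bullet> z\<close> on \<open>edom c\<close>, which contains the domain of the
  biconjugate.\<close>

lemma perspective_conjugate_le:
  fixes c :: "'a::euclidean_space \<Rightarrow> ereal"
  assumes c: "proper_closed_convex c" and nu: "\<nu> \<ge> 0"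
    and le: "\<And>z. z \<in> edom c \<Longrightarrow> y \<bullet> z - \<nu> * real_of_ereal (c z) \<le> s"
  shows "perspective (conjugate c) \<nu> y \<le> ereal s"
proof (cases "\<nu> > 0")
  case True
  have "conjugate c (y /\<^sub>R \<nu>) \<le> ereal (s / \<nu>)"
    unfolding conjugate_def
  proof (rule SUP_least)
    fix z
    show "ereal ((y /\<^sub>R \<nu>) \<bullet> z) - c z \<le> ereal (s / \<nu>)"
    proof (cases "z \<in> edom c")
      case False
      then show ?thesis by (simp add: edom_def)
    next
      case z: True
      have "((y /\<^sub>R \<nu>) \<bullet> z) - real_of_ereal (c z) \<le> s / \<nu>"
      proof -
        have "((y /\<^sub>R \<nu>) \<bullet> z) - real_of_ereal (c z) = (y \<bullet> z - \<nu> * real_of_ereal (c z)) / \<nu>"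
          using True by (simp add: field_simps)
        then show ?thesis using le[OF z] True by (simp add: divide_right_mono)
      qed
      then show ?thesis by (subst edom_ereal[OF c z]) simp
    qed
  qed
  then have "ereal \<nu> * conjugate c (y /\<^sub>R \<nu>) \<le> ereal \<nu> * ereal (s / \<nu>)"
    using nu by (intro ereal_mult_left_mono) auto
  also have "\<dots> = ereal s" using True by simp
  finally show ?thesis using True by (simp add: perspective_def)
next
  case False
  then have "\<nu> = 0" using nu by simp
  have "ereal (z \<bullet> y) \<le> ereal s" if "z \<in> edom (conjugate (conjugate c))" for z
    using le[of z] edom_biconjugate_subset[OF c] that \<open>\<nu> = 0\<close> by (auto simp: inner_commute)
  then show ?thesis
    using False by (auto simp: perspective_def support_fun_def intro: SUP_least)
qed

text \<open>Young's inequality for \<open>\<nu> * c\<close>, with the nonpositive term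
  \<open>\<nu> * c z\<close> dropped. At \<open>\<nu> = 0\<close> the point \<open>z\<close> belongs
  to the set of the support function since the biconjugate lies below \<open>c\<close>.\<close>

lemma perspective_conjugate_ge:
  fixes c :: "'a::euclidean_space \<Rightarrow> ereal"
  assumes c: "proper_closed_convex c" and nu: "\<nu> \<ge> 0" and z: "c z \<le> 0"
  shows "ereal (y \<bullet> z) \<le> perspective (conjugate c) \<nu> y"
proof -
  have "c z < \<infinity>" using z by (cases "c z") auto
  then obtain s where s: "c z = ereal s" using edom_ereal[OF c] by (auto simp: edom_def)
  then have s0: "s \<le> 0" using z by simp
  have conj: "ereal (w \<bullet> z - s) \<le> conjugate c w" for w
  proof -
    have "ereal (w \<bullet> z - s) = ereal (w \<bullet> z) - c z" by (simp add: s)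
    also have "\<dots> \<le> conjugate c w" unfolding conjugate_def by (intro SUP_upper) auto
    finally show ?thesis .
  qed
  show ?thesis
  proof (cases "\<nu> > 0")
    case True
    have "y \<bullet> z \<le> \<nu> * ((y /\<^sub>R \<nu>) \<bullet> z - s)"
      using True s0 by (simp add: right_diff_distrib mult_nonneg_nonpos flip: mult.assoc)
    then have "ereal (y \<bullet> z) \<le> ereal \<nu> * ereal ((y /\<^sub>R \<nu>) \<bullet> z - s)" by simp
    also have "\<dots> \<le> ereal \<nu> * conjugate c (y /\<^sub>R \<nu>)"
      using nu by (intro ereal_mult_left_mono conj) simp
    finally show ?thesis using True by (simp add: perspective_def)
  next
    case False
    have "conjugate (conjugate c) z \<le> ereal s"
    proof -
      have "ereal (z \<bullet> w) - conjugate c w \<le> ereal s" for w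
        using conj[of w] by (cases "conjugate c w") (auto simp: inner_commute)
      then show ?thesis unfolding conjugate_def[of "conjugate c"] by (intro SUP_least)
    qed
    then have "z \<in> edom (conjugate (conjugate c))" by (auto simp: edom_def)
    then have "ereal (z \<bullet> y) \<le> support_fun (edom (conjugate (conjugate c))) y"
      unfolding support_fun_def by (intro SUP_upper)
    then show ?thesis using False by (simp add: perspective_def inner_commute)
  qed
qed

lemma convex_on_edom:
  assumes c: "proper_closed_convex c"
  shows "convex_on (edom c) (\<lambda>z. real_of_ereal (c z))"
proof -
  have epi: "c (u *\<^sub>R x + v *\<^sub>R y) \<le> ereal (u * real_of_ereal (c x) + v * real_of_ereal (c y))"
    if xy: "x \<in> edom c" "y \<in> edom c" and uv: "0 \<le> u" "0 \<le> v" "u + v = 1" for x y u v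
  proof -
    have "convex {(x, r::real). c x \<le> ereal r}"
      using proper_closed_convexD(4)[OF c] by (simp add: convex_fun_def)
    moreover have "(x, real_of_ereal (c x)) \<in> {(x, r::real). c x \<le> ereal r}"
      "(y, real_of_ereal (c y)) \<in> {(x, r::real). c x \<le> ereal r}"
      using edom_ereal[OF c] xy by (auto simp del: ereal_real)
    ultimately have "u *\<^sub>R (x, real_of_ereal (c x)) + v *\<^sub>R (y, real_of_ereal (c y)) \<in> {(x, r::real). c x \<le> ereal r}"
      using uv by (rule convexD)
    then show ?thesis by simp
  qed
  have dom: "u *\<^sub>R x + v *\<^sub>R y \<in> edom c"
    if "x \<in> edom c" "y \<in> edom c" "0 \<le> u" "0 \<le> v" "u + v = 1" for x y u v
    using epi[OF that] unfolding edom_def by (metis (mono_tags) ereal_infty_less(1) less_ereal.simps(4) mem_Collect_eq order_le_less_trans)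
  show ?thesis
    unfolding convex_on_def
  proof (intro conjI ballI allI impI)
    show "convex (edom c)" using dom by (intro convexI) auto
    fix x y u v assume A: "x \<in> edom c" "y \<in> edom c" "(0::real) \<le> u" "0 \<le> v" "u + v = 1"
    have "ereal (real_of_ereal (c (u *\<^sub>R x + v *\<^sub>R y))) \<le> ereal (u * real_of_ereal (c x) + v * real_of_ereal (c y))"
      using epi[OF A] edom_ereal[OF c dom[OF A]] by metis
    then show "real_of_ereal (c (u *\<^sub>R x + v *\<^sub>R y)) \<le> u * real_of_ereal (c x) + v * real_of_ereal (c y)"
      by simp
  qed
qed

section \<open>Strong duality for a single concave maximization\<close>

text \<open>A dual feasible point that certifies \<open>m \<le> g\<close> on the sublevel set; the multiplier \<open>y 0 = - (\<Sum>l. y l)\<close>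
  of the reformulation is eliminated, and its conjugate appears as the condition for all \<open>z\<close>.\<close>

definition dual_bound :: "nat \<Rightarrow> (nat \<Rightarrow> 'a::euclidean_space \<Rightarrow> ereal) \<Rightarrow> ('a \<Rightarrow> real) \<Rightarrow> real \<Rightarrow> bool" where
  "dual_bound L c g m \<longleftrightarrow> (\<exists>y \<nu> s.
     (\<forall>l\<in>{1..L}. 0 \<le> \<nu> l \<and> perspective (conjugate (c l)) (\<nu> l) (y l) \<le> ereal (s l)) \<and>
     (\<forall>z. m \<le> g z + (\<Sum>l\<in>{1..L}. y l \<bullet> z - s l)))"

lemma dual_boundI:
  assumes c: "\<And>l. l \<in> {1..L} \<Longrightarrow> proper_closed_convex (c l)"
    and nu: "\<And>l. l \<in> {1..L} \<Longrightarrow> 0 \<le> \<nu> l"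
    and ys: "\<And>l z. l \<in> {1..L} \<Longrightarrow> z \<in> edom (c l) \<Longrightarrow> y l \<bullet> z - \<nu> l * real_of_ereal (c l z) \<le> s l"
    and m: "\<And>z. m \<le> g z + (\<Sum>l\<in>{1..L}. y l \<bullet> z - s l)"
  shows "dual_bound L c g m"
  unfolding dual_bound_def using assms
  by (intro exI[of _ y] exI[of _ \<nu>] exI[of _ s]) (auto intro!: perspective_conjugate_le)

lemma dual_bound_slater:
  fixes g :: "'a::euclidean_space \<Rightarrow> real"
  assumes g: "convex_on UNIV g"
    and c: "\<And>l. l \<in> {1..L} \<Longrightarrow> proper_closed_convex (c l)"
    and slater: "slater_point {1..L} c z0"
    and m: "\<And>z. z \<in> sublevel_set {1..L} c \<Longrightarrow> m \<le> g z"
  shows "dual_bound L c g m"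
proof -
  define A where "A = {l\<in>{1..L}. affine_fun (c l)}"
  define N where "N = {1..L} - A"
  have AN: "finite A" "finite N" "A \<inter> N = {}" "A \<union> N = {1..L}" by (auto simp: A_def N_def)
  have "\<forall>l\<in>A. \<exists>a b. \<forall>z. c l z = ereal (a \<bullet> z + b)" by (auto simp: A_def affine_fun_def)
  then obtain a b where ab: "\<And>l z. l \<in> A \<Longrightarrow> c l z = ereal (a l \<bullet> z + b l)" by metis
  define q where "q l z = real_of_ereal (c l z)" for l z
  have z0ri: "z0 \<in> rel_interior (edom (c l))" if "l \<in> {1..L}" for l
    using slater that by (auto simp: slater_point_def)
  have z0dom: "z0 \<in> edom (c l)" if "l \<in> {1..L}" for l
    using z0ri[OF that] rel_interior_subset by blast
  have cq: "c l z = ereal (q l z)" if "l \<in> {1..L}" "z \<in> edom (c l)" for l z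
    using edom_ereal[OF c[OF that(1)] that(2)] by (simp only: q_def)
  have qconv: "convex_on (edom (c l)) (q l)" if "l \<in> {1..L}" for l
    using convex_on_edom[OF c[OF that]] by (simp only: q_def[abs_def])
  have qA: "q l z = a l \<bullet> z + b l" if "l \<in> A" for l z using ab[OF that] by (simp add: q_def)
  have domA: "edom (c l) = UNIV" if "l \<in> A" for l using ab[OF that] by (simp add: edom_def)
  have z0A: "a l \<bullet> z0 + b l \<le> 0" if "l \<in> A" for l
  proof -
    have "c l z0 \<le> 0" using slater that by (auto simp: slater_point_def sublevel_set_def A_def)
    then show ?thesis by (simp add: ab[OF that])
  qed
  have z0N: "q l z0 < 0" if "l \<in> N" for l
    using slater that cq[OF _ z0dom, of l] AN by (force simp: slater_point_def N_def A_def)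
  define D where "D = (\<Inter>l\<in>N. edom (c l))"
  have "convex (edom (c l))" if "l \<in> {1..L}" for l
    using qconv[OF that] by (rule convex_on_imp_convex)
  then have D: "convex D" "z0 \<in> rel_interior D"
    using AN z0ri by (auto simp: D_def intro!: convex_INT rel_interior_INT)
  \<comment> \<open>Over this set \<open>z0\<close> may lie on the relative boundary, but the
    nonlinear constraints only ask for strictness at \<open>z0\<close>.\<close>
  let ?S = "{z\<in>D. \<forall>k\<in>A. a k \<bullet> z + b k \<le> 0}"
  have S: "convex ?S" using D by (intro convex_constraints convex_on_affine_fun)
  have qconvD: "convex_on D (q l)" if "l \<in> N" for l
    using AN that by (intro convex_on_subset[OF qconv] D(1)) (auto simp: D_def)
  have feas: "m \<le> g z" if "z \<in> ?S" "\<forall>l\<in>N. q l z \<le> 0" for z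
  proof (rule m)
    have "c l z \<le> 0" if l: "l \<in> {1..L}" for l
    proof (cases "l \<in> A")
      case True
      then show ?thesis using ab \<open>z \<in> ?S\<close> by simp
    next
      case False
      then have lN: "l \<in> N" using l by (simp add: N_def)
      then have "z \<in> edom (c l)" using \<open>z \<in> ?S\<close> by (auto simp: D_def)
      then show ?thesis using cq[OF l] \<open>\<forall>l\<in>N. q l z \<le> 0\<close> lN by simp
    qed
    then show "z \<in> sublevel_set {1..L} c" by (auto simp: sublevel_set_def)
  qed
  have z0S: "z0 \<in> ?S" using D(2) rel_interior_subset z0A by blast
  have qconvS: "convex_on ?S (q l)" if "l \<in> N" for l
    by (rule convex_on_subset[OF qconvD[OF that] _ S]) auto
  have gS: "convex_on ?S g" by (rule convex_on_subset[OF g _ S]) auto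
  have "\<exists>\<nu>. (\<forall>l\<in>N. \<nu> l \<ge> 0) \<and> (\<forall>z\<in>?S. m \<le> g z + (\<Sum>l\<in>N. \<nu> l * q l z))"
    by (rule strict_inequality_multipliers[where S = ?S and q = q, OF AN(2) gS qconvS z0S z0N feas])
  then obtain \<nu>N where nuN: "\<forall>l\<in>N. \<nu>N l \<ge> 0"
    "\<forall>z\<in>?S. m \<le> g z + (\<Sum>l\<in>N. \<nu>N l * q l z)" by blast
  have gD: "convex_on D (\<lambda>z. g z + (\<Sum>l\<in>N. \<nu>N l * q l z))"
  proof (intro convex_on_add convex_on_sum_fun convex_on_cmul D(1))
    show "convex_on D g" by (rule convex_on_subset[OF g _ D(1)]) simp
  qed (use nuN(1) qconvD in auto)
  have "m \<le> g z + (\<Sum>l\<in>N. \<nu>N l * q l z)" if "z \<in> D" "\<forall>k\<in>A. a k \<bullet> z + b k \<le> 0" for z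
    using nuN(2) that by blast
  from affine_multipliers[where a = a and b = b and m = m, OF AN(1) gD D(2) z0A this]
  have "\<exists>\<mu>. (\<forall>k\<in>A. 0 \<le> \<mu> k) \<and>
    (\<forall>z\<in>D. m \<le> (g z + (\<Sum>l\<in>N. \<nu>N l * q l z)) + (\<Sum>k\<in>A. \<mu> k * (a k \<bullet> z + b k)))" .
  then obtain \<nu>A where nuA: "\<forall>k\<in>A. 0 \<le> \<nu>A k"
    "\<forall>z\<in>D. m \<le> (g z + (\<Sum>l\<in>N. \<nu>N l * q l z)) + (\<Sum>k\<in>A. \<nu>A k * (a k \<bullet> z + b k))"
    by blast
  define \<nu> where "\<nu> l = (if l \<in> A then \<nu>A l else \<nu>N l)" for l
  have nu: "0 \<le> \<nu> l" if "l \<in> {1..L}" for l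
    using that nuN(1) nuA(1) by (auto simp: \<nu>_def N_def)
  have lagr: "m \<le> g z + (\<Sum>l\<in>{1..L}. \<nu> l * q l z)" if "\<forall>l\<in>{1..L}. z \<in> edom (c l)" for z
  proof -
    have "(\<Sum>l\<in>{1..L}. \<nu> l * q l z) = (\<Sum>l\<in>A. \<nu> l * q l z) + (\<Sum>l\<in>N. \<nu> l * q l z)"
      using sum.union_disjoint[OF AN(1,2,3)] AN(4) by metis
    also have "(\<Sum>l\<in>A. \<nu> l * q l z) = (\<Sum>k\<in>A. \<nu>A k * (a k \<bullet> z + b k))"
      by (intro sum.cong) (auto simp: \<nu>_def qA)
    also have "(\<Sum>l\<in>N. \<nu> l * q l z) = (\<Sum>l\<in>N. \<nu>N l * q l z)"
      by (intro sum.cong) (auto simp: \<nu>_def N_def)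
    finally have eq: "(\<Sum>l\<in>{1..L}. \<nu> l * q l z) =
      (\<Sum>k\<in>A. \<nu>A k * (a k \<bullet> z + b k)) + (\<Sum>l\<in>N. \<nu>N l * q l z)" .
    have "z \<in> D" using that AN(4) unfolding D_def by blast
    then show ?thesis using nuA(2) unfolding eq by (simp add: add_ac)
  qed
  \<comment> \<open>A constraint with \<open>\<nu> l = 0\<close> still contributes its domain. Its
    share of the splitting bounds \<open>y l \<bullet> z\<close> by \<open>s l\<close> there, as the
    support function branch of the perspective requires.\<close>
  have "convex_on (edom (c l)) (\<lambda>z. \<nu> l * q l z)" if "l \<in> {1..L}" for l
    using nu[OF that] qconv[OF that] by (rule convex_on_cmul)
  from convex_on_split_sum[where N = "{1..L}" and D = "\<lambda>l. edom (c l)" and \<psi> = "\<lambda>l z. \<nu> l * q l z",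
      OF _ g this z0ri lagr]
  obtain y s where "\<forall>l\<in>{1..L}. \<forall>z\<in>edom (c l). y l \<bullet> z - \<nu> l * q l z \<le> s l"
    "\<forall>z. m \<le> g z + (\<Sum>l\<in>{1..L}. y l \<bullet> z - s l)" by auto
  then show ?thesis
    by (intro dual_boundI[where \<nu> = \<nu> and y = y and s = s] c nu) (auto simp: q_def)
qed

text \<open>A compact feasible set needs no Slater point: finitely many affine minorants of the
  constraint functions already confine their common sublevel set to a ball on which \<open>m < g\<close>.\<close>

lemma dual_bound_compact:
  fixes g :: "'a::euclidean_space \<Rightarrow> real"
  assumes g: "convex_on UNIV g"
    and c: "\<And>l. l \<in> {1..L} \<Longrightarrow> proper_closed_convex (c l)"
    and Z: "compact (sublevel_set {1..L} c)" "sublevel_set {1..L} c \<noteq> {}"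
    and m: "\<And>z. z \<in> sublevel_set {1..L} c \<Longrightarrow> m < g z"
  shows "dual_bound L c g m"
proof -
  let ?Z = "sublevel_set {1..L} c"
  obtain z0 where z0: "z0 \<in> ?Z" using Z(2) by auto
  obtain R where R: "R > 0" "?Z \<subseteq> ball z0 R"
    using bounded_subset_ballD[OF compact_imp_bounded[OF Z(1)]] by blast
  \<comment> \<open>The points to be excluded: the sphere, and the part of the ball where
    \<open>g\<close> violates the bound. Excluding a compact set takes only finitely many
    half-spaces.\<close>
  define T where "T = sphere z0 R \<union> (cball z0 R \<inter> {z. g z \<le> m})"
  have "closed {z. g z \<le> m}"
    using convex_on_continuous[OF open_UNIV g] by (intro closed_Collect_le) auto
  then have T: "compact T" unfolding T_def by (intro compact_Un compact_Int_closed) auto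
  \<comment> \<open>All affine minorants, tagged with the index of their constraint so that the
    multipliers can be regrouped by constraint.\<close>
  define M where "M = {(l, a, b). l \<in> {1..L} \<and> (\<forall>w. ereal (a \<bullet> w + b) \<le> c l w)}"
  define \<alpha> where "\<alpha> = (\<lambda>p::nat \<times> 'a \<times> real. fst (snd p))"
  define \<beta> where "\<beta> = (\<lambda>p::nat \<times> 'a \<times> real. snd (snd p))"
  have Mle: "ereal (\<alpha> p \<bullet> w + \<beta> p) \<le> c (fst p) w" and Ml: "fst p \<in> {1..L}" if "p \<in> M" for p w
    using that by (auto simp: M_def \<alpha>_def \<beta>_def)
  let ?H = "\<lambda>p. {z. \<alpha> p \<bullet> z + \<beta> p \<le> 0}"
  have MZ: "(\<Inter>p\<in>M. ?H p) \<subseteq> ?Z"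
  proof
    fix z assume z: "z \<in> (\<Inter>p\<in>M. ?H p)"
    have "c l z \<le> 0" if l: "l \<in> {1..L}" for l
    proof (rule ccontr)
      assume "\<not> c l z \<le> 0"
      then have "ereal 0 < c l z" by (simp add: zero_ereal_def)
      then obtain a b where "\<forall>w. ereal (a \<bullet> w + b) \<le> c l w" "0 < a \<bullet> z + b"
        using affine_minorant_above[OF c[OF l]] by blast
      then have "(l, a, b) \<in> M" "z \<notin> ?H (l, a, b)" using l by (auto simp: M_def \<alpha>_def \<beta>_def)
      then show False using z by blast
    qed
    then show "z \<in> ?Z" by (simp add: sublevel_set_def)
  qed
  have "T \<inter> ?Z = {}" using R(2) m by (fastforce simp: T_def)
  then have disj: "T \<inter> (\<Inter>p\<in>M. ?H p) = {}" using MZ by blast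
  have "\<exists>K. finite K \<and> K \<subseteq> M \<and> T \<inter> (\<Inter>p\<in>K. ?H p) = {}"
  proof (rule ccontr)
    assume neg: "\<not> ?thesis"
    have "T \<inter> (\<Inter>p\<in>M. ?H p) \<noteq> {}"
    proof (rule compact_imp_fip_image[OF T])
      show "closed (?H p)" for p by (intro closed_Collect_le continuous_intros)
      fix K assume "finite K" "K \<subseteq> M"
      show "T \<inter> (\<Inter>p\<in>K. ?H p) \<noteq> {}"
      proof
        assume "T \<inter> (\<Inter>p\<in>K. ?H p) = {}"
        with \<open>finite K\<close> \<open>K \<subseteq> M\<close>
        have "\<exists>K. finite K \<and> K \<subseteq> M \<and> T \<inter> (\<Inter>p\<in>K. ?H p) = {}" by (intro exI[of _ K] conjI)
        with neg show False by (rule notE)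
      qed
    qed
    then show False using disj by simp
  qed
  then obtain K where K: "finite K" "K \<subseteq> M" "T \<inter> (\<Inter>p\<in>K. ?H p) = {}" by (elim exE conjE)
  have z0K: "\<alpha> p \<bullet> z0 + \<beta> p \<le> 0" if "p \<in> K" for p
  proof -
    have p: "p \<in> M" using that K(2) by auto
    have "ereal (\<alpha> p \<bullet> z0 + \<beta> p) \<le> c (fst p) z0" by (rule Mle[OF p])
    also have "\<dots> \<le> 0" using z0 Ml[OF p] by (simp add: sublevel_set_def)
    finally show ?thesis by simp
  qed
  \<comment> \<open>The polyhedron given by \<open>K\<close> is convex, contains \<open>z0\<close>
    and misses the sphere, so a segment from \<open>z0\<close> cannot leave the ball inside
    it.\<close>
  have far: "z \<in> ball z0 R" if z: "\<forall>p\<in>K. \<alpha> p \<bullet> z + \<beta> p \<le> 0" for z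
  proof (rule ccontr)
    assume "z \<notin> ball z0 R"
    then have d: "R \<le> dist z0 z" by simp
    define t where "t = R / dist z0 z"
    have t: "0 \<le> t" "t \<le> 1" using R(1) d by (auto simp: t_def divide_le_eq)
    define w where "w = z0 + t *\<^sub>R (z - z0)"
    have "dist z0 w = R" using R(1) d by (force simp: w_def t_def dist_norm norm_minus_commute)
    then have "w \<in> T" by (simp add: T_def)
    moreover have "w \<in> ?H p" if "p \<in> K" for p
    proof -
      have "\<alpha> p \<bullet> w + \<beta> p = (1 - t) * (\<alpha> p \<bullet> z0 + \<beta> p) + t * (\<alpha> p \<bullet> z + \<beta> p)"
        by (simp add: w_def algebra_simps)
      also have "\<dots> \<le> 0"
        using t z[rule_format, OF that] z0K[OF that]
        by (intro add_nonpos_nonpos[of "(1 - t) * _"] mult_nonneg_nonpos) simp_all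
      finally show ?thesis by simp
    qed
    ultimately show False using K(3) by blast
  qed
  have "m \<le> g z" if z: "\<forall>p\<in>K. \<alpha> p \<bullet> z + \<beta> p \<le> 0" for z
  proof -
    have "z \<notin> T" using K(3) z by blast
    then show ?thesis using far[OF z] by (simp add: T_def)
  qed
  then have "\<exists>\<mu>. (\<forall>p\<in>K. 0 \<le> \<mu> p) \<and>
      (\<forall>z\<in>UNIV. m \<le> g z + (\<Sum>p\<in>K. \<mu> p * (\<alpha> p \<bullet> z + \<beta> p)))"
    by (intro affine_multipliers[where a = \<alpha> and b = \<beta>, OF K(1) g _ z0K]) auto
  then obtain \<mu> where mu: "\<forall>p\<in>K. 0 \<le> \<mu> p"
      "\<forall>z. m \<le> g z + (\<Sum>p\<in>K. \<mu> p * (\<alpha> p \<bullet> z + \<beta> p))" by blast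
  \<comment> \<open>A nonnegative combination of minorants of \<open>c l\<close> lies below
    \<open>\<nu> l * c l\<close>, where \<open>\<nu> l\<close> is the total weight. Its slope is
    \<open>y l\<close> and its constant term \<open>- s l\<close>; all are zero if no minorant of
    \<open>c l\<close> was selected.\<close>
  let ?K = "\<lambda>l. {p\<in>K. fst p = l}"
  define \<nu> where "\<nu> l = (\<Sum>p\<in>?K l. \<mu> p)" for l
  define y where "y l = (\<Sum>p\<in>?K l. \<mu> p *\<^sub>R \<alpha> p)" for l
  define s where "s l = (\<Sum>p\<in>?K l. - (\<mu> p * \<beta> p))" for l
  have ys: "y l \<bullet> z - s l = (\<Sum>p\<in>?K l. \<mu> p * (\<alpha> p \<bullet> z + \<beta> p))" for l z
    by (simp add: y_def s_def inner_sum_left distrib_left sum.distrib sum_negf)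
  show ?thesis
  proof (rule dual_boundI[OF c])
    show "0 \<le> \<nu> l" for l unfolding \<nu>_def using mu(1) by (intro sum_nonneg) auto
    show "y l \<bullet> z - \<nu> l * real_of_ereal (c l z) \<le> s l" if l: "l \<in> {1..L}" and z: "z \<in> edom (c l)" for l z
    proof -
      have "\<mu> p * (\<alpha> p \<bullet> z + \<beta> p) \<le> \<mu> p * real_of_ereal (c l z)" if p: "p \<in> ?K l" for p
      proof -
        have "ereal (\<alpha> p \<bullet> z + \<beta> p) \<le> ereal (real_of_ereal (c l z))"
          using Mle[of p z] p K(2) edom_ereal[OF c[OF l] z] by auto
        then show ?thesis using mu(1) p by (intro mult_left_mono) auto
      qed
      then have "y l \<bullet> z - s l \<le> (\<Sum>p\<in>?K l. \<mu> p * real_of_ereal (c l z))"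
        unfolding ys by (intro sum_mono)
      then show ?thesis by (simp add: \<nu>_def sum_distrib_right)
    qed
    show "m \<le> g z + (\<Sum>l\<in>{1..L}. y l \<bullet> z - s l)" for z
    proof -
      have "(\<Sum>l\<in>{1..L}. y l \<bullet> z - s l) = (\<Sum>p\<in>K. \<mu> p * (\<alpha> p \<bullet> z + \<beta> p))"
        unfolding ys using K Ml by (intro sum.group) auto
      then show ?thesis using mu(2) by simp
    qed
  qed
qed

section \<open>The robust problem and its reformulation\<close>

text \<open>The linear terms \<open>y i l \<bullet> z\<close> of the bounds for the single summands
  cancel because the \<open>y i l\<close> sum to zero; \<open>f i x z\<close> is left.\<close>

lemma PW'_expr_ge:
  fixes c :: "nat \<Rightarrow> 'b::euclidean_space \<Rightarrow> ereal"
  assumes c: "\<And>l. l \<in> {1..L} \<Longrightarrow> proper_closed_convex (c l)"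
    and nu: "\<And>l. l \<in> {1..L} \<Longrightarrow> 0 \<le> \<nu> i l"
    and y: "(\<Sum>l\<in>{0..L}. y i l) = 0"
    and z: "z \<in> sublevel_set {1..L} c"
    and f: "f i x z = ereal r"
  shows "f i x z \<le> PW'_expr L c f i (x, y, \<nu>)"
proof -
  have "ereal (y i 0 \<bullet> z + r) = ereal (y i 0 \<bullet> z) - (- f i x z)" by (simp add: f)
  also have "\<dots> \<le> partial_conjugate2 (\<lambda>x z. - f i x z) x (y i 0)"
    unfolding partial_conjugate2_def by (intro SUP_upper) auto
  finally have pc: "ereal (y i 0 \<bullet> z + r) \<le> partial_conjugate2 (\<lambda>x z. - f i x z) x (y i 0)" .
  have "ereal (y i l \<bullet> z) \<le> perspective (conjugate (c l)) (\<nu> i l) (y i l)" if "l \<in> {1..L}" for l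
    using z that by (intro perspective_conjugate_ge c nu) (auto simp: sublevel_set_def)
  then have ps: "(\<Sum>l\<in>{1..L}. ereal (y i l \<bullet> z))
      \<le> (\<Sum>l\<in>{1..L}. perspective (conjugate (c l)) (\<nu> i l) (y i l))"
    by (intro sum_mono)
  have "y i 0 \<bullet> z + (\<Sum>l\<in>{1..L}. y i l \<bullet> z) = (\<Sum>l\<in>{0..L}. y i l) \<bullet> z"
    by (simp add: sum.atLeast_Suc_atMost inner_add_left inner_sum_left)
  then have "f i x z = ereal (y i 0 \<bullet> z + r) + (\<Sum>l\<in>{1..L}. ereal (y i l \<bullet> z))"
    by (simp add: f y)
  also have "\<dots> \<le> PW'_expr L c f i (x, y, \<nu>)"
    unfolding PW'_expr_def prod.case using pc ps by (rule add_mono)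
  finally show ?thesis .
qed

text \<open>The bound is stated for all arrays whose row \<open>i\<close> is the given one, so that
  rows found separately for each \<open>i\<close> can be assembled into one solution.\<close>

lemma dual_bound_PW'_expr:
  fixes c :: "nat \<Rightarrow> 'b::euclidean_space \<Rightarrow> ereal"
  assumes f: "\<And>z. f i x z = ereal (- g z)" and "dual_bound L c g m"
  shows "\<exists>y' \<nu>'. (\<forall>l\<in>{1..L}. 0 \<le> \<nu>' l) \<and> (\<Sum>l\<in>{0..L}. y' l) = 0 \<and>
    (\<forall>y \<nu>. y i = y' \<longrightarrow> \<nu> i = \<nu>' \<longrightarrow> PW'_expr L c f i (x, y, \<nu>) \<le> ereal (- m))"
proof -
  from assms(2) obtain y0 \<nu>' s where
    *: "\<forall>l\<in>{1..L}. 0 \<le> \<nu>' l \<and> perspective (conjugate (c l)) (\<nu>' l) (y0 l) \<le> ereal (s l)"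
    and m: "\<forall>z. m \<le> g z + (\<Sum>l\<in>{1..L}. y0 l \<bullet> z - s l)"
    unfolding dual_bound_def by blast
  define w where "w = - (\<Sum>l\<in>{1..L}. y0 l)"
  define y' where "y' = (\<lambda>l. if l = 0 then w else y0 l)"
  have y': "(\<Sum>l\<in>{1..L}. y' l) = (\<Sum>l\<in>{1..L}. y0 l)" by (intro sum.cong) (auto simp: y'_def)
  have "(\<Sum>l\<in>{0..L}. y' l) = y' 0 + (\<Sum>l\<in>{1..L}. y' l)" by (simp add: sum.atLeast_Suc_atMost)
  then have sum0: "(\<Sum>l\<in>{0..L}. y' l) = 0" unfolding y' by (simp add: y'_def w_def)
  have "PW'_expr L c f i (x, y, \<nu>) \<le> ereal (- m)" if yi: "y i = y'" "\<nu> i = \<nu>'" for y \<nu>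
  proof -
    have "partial_conjugate2 (\<lambda>x z. - f i x z) x w \<le> ereal (- m - (\<Sum>l\<in>{1..L}. s l))"
      unfolding partial_conjugate2_def
    proof (rule SUP_least)
      fix z
      have "w \<bullet> z - g z \<le> - m - (\<Sum>l\<in>{1..L}. s l)"
        using m[rule_format, of z] by (simp add: w_def inner_sum_left sum_subtractf)
      then show "ereal (w \<bullet> z) - (- f i x z) \<le> ereal (- m - (\<Sum>l\<in>{1..L}. s l))"
        by (simp add: f)
    qed
    moreover have "(\<Sum>l\<in>{1..L}. perspective (conjugate (c l)) (\<nu>' l) (y' l)) \<le> (\<Sum>l\<in>{1..L}. ereal (s l))"
      using * by (intro sum_mono) (auto simp: y'_def)
    ultimately have "PW'_expr L c f i (x, y, \<nu>)
        \<le> ereal (- m - (\<Sum>l\<in>{1..L}. s l)) + (\<Sum>l\<in>{1..L}. ereal (s l))"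
      unfolding PW'_expr_def prod.case yi by (intro add_mono) (auto simp: y'_def)
    then show ?thesis by simp
  qed
  then show ?thesis using * sum0 by blast
qed

lemma dual_bounds_PW':
  fixes c :: "nat \<Rightarrow> 'b::euclidean_space \<Rightarrow> ereal"
  assumes "\<And>i z. i \<in> {0..I} \<Longrightarrow> f i x z = ereal (- g i z)"
    and "\<And>i. i \<in> {0..I} \<Longrightarrow> dual_bound L c (g i) (m i)"
    and "\<And>i. i \<in> {1..I} \<Longrightarrow> 0 \<le> m i"
  shows "\<exists>v\<in>PW'_constraints I L c f. PW'_objective L c f v \<le> ereal (- m 0)"
proof -
  have "\<forall>i\<in>{0..I}. \<exists>y' \<nu>'. (\<forall>l\<in>{1..L}. 0 \<le> \<nu>' l) \<and> (\<Sum>l\<in>{0..L}. y' l) = 0 \<and>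
    (\<forall>y \<nu>. y i = y' \<longrightarrow> \<nu> i = \<nu>' \<longrightarrow> PW'_expr L c f i (x, y, \<nu>) \<le> ereal (- m i))"
  proof
    fix i assume i: "i \<in> {0..I}"
    show "\<exists>y' \<nu>'. (\<forall>l\<in>{1..L}. 0 \<le> \<nu>' l) \<and> (\<Sum>l\<in>{0..L}. y' l) = 0 \<and>
      (\<forall>y \<nu>. y i = y' \<longrightarrow> \<nu> i = \<nu>' \<longrightarrow> PW'_expr L c f i (x, y, \<nu>) \<le> ereal (- m i))"
      by (rule dual_bound_PW'_expr[where g = "g i"]) (use assms(1,2) i in auto)
  qed
  then obtain y \<nu> where *: "\<forall>i\<in>{0..I}. (\<forall>l\<in>{1..L}. 0 \<le> \<nu> i l) \<and> (\<Sum>l\<in>{0..L}. y i l) = 0 \<and>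
      PW'_expr L c f i (x, y, \<nu>) \<le> ereal (- m i)"
    by metis
  have "PW'_expr L c f i (x, y, \<nu>) \<le> 0" if "i \<in> {1..I}" for i
  proof -
    have "PW'_expr L c f i (x, y, \<nu>) \<le> ereal (- m i)" using * that by auto
    also have "\<dots> \<le> 0" using assms(3)[OF that] by simp
    finally show ?thesis .
  qed
  then have "(x, y, \<nu>) \<in> PW'_constraints I L c f" using * by (simp add: PW'_constraints_def)
  then show ?thesis using * by (intro bexI[of _ "(x, y, \<nu>)"]) (auto simp: PW'_objective_def)
qed

lemma optimal_value_le_of_map:
  assumes "\<And>v. v \<in> C' \<Longrightarrow> \<pi> v \<in> C \<and> F (\<pi> v) \<le> F' v"
  shows "optimal_value C F \<le> optimal_value C' F'"
  unfolding optimal_value_def using assms by (intro INF_mono) blast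

text \<open>The image of an optimal solution is squeezed between the equal optimal values. If the
  mapped problem is infeasible, the common value is infinite, so the other problem is infeasible and
  hence solvable by convention.\<close>

lemma solvable_of_map:
  assumes map: "\<And>v. v \<in> C' \<Longrightarrow> \<pi> v \<in> C \<and> F (\<pi> v) \<le> F' v"
    and eq: "optimal_value C F = optimal_value C' F'"
    and solv: "solvable C' F'"
  shows "solvable C F"
proof (cases "\<exists>v. feasible C' F' v")
  case True
  then obtain v where v: "feasible C' F' v" "F' v = optimal_value C' F'"
    using solv by (auto simp: solvable_def)
  have pv: "\<pi> v \<in> C" "F (\<pi> v) \<le> F' v" using map v(1) by (auto simp: feasible_def)
  have "optimal_value C F \<le> F (\<pi> v)"
    unfolding optimal_value_def using pv(1) by (rule INF_lower)
  then have "F (\<pi> v) = optimal_value C F" using pv(2) v(2) eq by simp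
  moreover have "feasible C F (\<pi> v)" using pv v(1) by (auto simp: feasible_def)
  ultimately show ?thesis by (auto simp: solvable_def)
next
  case False
  then have "optimal_value C' F' = \<infinity>"
    unfolding optimal_value_def feasible_def by (intro antisym INF_greatest) auto
  then have "\<infinity> \<le> F x" if "x \<in> C" for x
    using eq that unfolding optimal_value_def by (metis INF_lower)
  then show ?thesis by (auto simp: solvable_def feasible_def)
qed

lemma real_valued_family:
  assumes "\<And>z. proper_closed_convex (\<lambda>x. h x z)" "\<And>x. proper_closed_convex (\<lambda>z. - h x z)"
  shows "h x z = ereal (real_of_ereal (h x z))"
    and "convex_on UNIV (\<lambda>x. real_of_ereal (h x z))"
    and "convex_on UNIV (\<lambda>z. - real_of_ereal (h x z))"
proof -
  have fin: "\<bar>h x z\<bar> \<noteq> \<infinity>" for x z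
    using proper_closed_convexD(1)[OF assms(1)[of z], of x]
      proper_closed_convexD(1)[OF assms(2)[of x], of z] by (cases "h x z") auto
  then show "h x z = ereal (real_of_ereal (h x z))" by (simp add: ereal_real')
  have "h x z < \<infinity>" "- h x z < \<infinity>" for x z
    using fin[of x z] by (cases "h x z"; simp)+
  then have "edom (\<lambda>x. h x z) = UNIV" "edom (\<lambda>z. - h x z) = UNIV"
    by (simp_all add: edom_def)
  then show "convex_on UNIV (\<lambda>x. real_of_ereal (h x z))"
    "convex_on UNIV (\<lambda>z. - real_of_ereal (h x z))"
    using convex_on_edom[OF assms(1)[of z]] convex_on_edom[OF assms(2)[of x]] by simp_all
qed

lemma worst_case_attained:
  assumes "compact Z" "Z \<noteq> {}" "continuous_on Z g" "\<And>z. f i x z = ereal (- g z)"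
  shows "\<exists>z\<in>Z. worst_case Z f i x = f i x z"
proof -
  obtain z where z: "z \<in> Z" "\<And>w. w \<in> Z \<Longrightarrow> g z \<le> g w"
    using continuous_attains_inf[OF assms(1-3)] by blast
  have "worst_case Z f i x = f i x z"
    unfolding worst_case_def using z assms(4) by (intro antisym SUP_least SUP_upper) auto
  then show ?thesis using z(1) by blast
qed

theorem proposition4:
  fixes I L :: nat
    and c :: "nat \<Rightarrow> real ^ 'dz \<Rightarrow> ereal"
    and f :: "nat \<Rightarrow> real ^ 'dx \<Rightarrow> real ^ 'dz \<Rightarrow> ereal"
    and Z :: "(real ^ 'dz) set"
  assumes c_pcc: "\<And>l. l \<in> {1..L} \<Longrightarrow> proper_closed_convex (c l)"
    and Z_def: "Z = sublevel_set {1..L} c"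
    and Z_nonempty: "Z \<noteq> {}"
    and f_convex: "\<And>i z. i \<in> {0..I} \<Longrightarrow> proper_closed_convex (\<lambda>x. f i x z)"
    and f_concave: "\<And>i x. i \<in> {0..I} \<Longrightarrow> proper_closed_convex (\<lambda>z. - f i x z)"
  shows
    "optimal_value (PW_constraints I Z f) (PW_objective Z f)
       \<le> optimal_value (PW'_constraints I L c f) (PW'_objective L c f)
     \<and> ((\<exists>z. slater_point {1..L} c z) \<longrightarrow>
         optimal_value (PW_constraints I Z f) (PW_objective Z f)
           = optimal_value (PW'_constraints I L c f) (PW'_objective L c f) \<and>
         (solvable (PW_constraints I Z f) (PW_objective Z f) \<longleftrightarrow>
          solvable (PW'_constraints I L c f) (PW'_objective L c f)))
     \<and> (compact Z \<and>
        (\<exists>x. problem_strict_slater_point (PW_objective Z f) {1..I} (worst_case Z f) x) \<longrightarrow>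
         optimal_value (PW_constraints I Z f) (PW_objective Z f)
           = optimal_value (PW'_constraints I L c f) (PW'_objective L c f) \<and>
         (solvable (PW'_constraints I L c f) (PW'_objective L c f) \<longrightarrow>
          solvable (PW_constraints I Z f) (PW_objective Z f)))"
proof -
  let ?C = "PW_constraints I Z f" and ?F = "PW_objective Z f"
  let ?C' = "PW'_constraints I L c f" and ?F' = "PW'_objective L c f"
  define fr where "fr i x z = real_of_ereal (f i x z)" for i x z
  have f_fr: "f i x z = ereal (fr i x z)" if "i \<in> {0..I}" for i x z
    using real_valued_family(1)[of "f i"] f_convex f_concave that unfolding fr_def by blast
  have fr_convex: "convex_on UNIV (\<lambda>x. fr i x z)" if "i \<in> {0..I}" for i z
    using real_valued_family(2)[of "f i"] f_convex f_concave that unfolding fr_def by blast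
  have fr_concave: "convex_on UNIV (\<lambda>z. - fr i x z)" if "i \<in> {0..I}" for i x
    using real_valued_family(3)[of "f i"] f_convex f_concave that unfolding fr_def by blast
  have Zne: "sublevel_set {1..L} c \<noteq> {}" using Z_nonempty Z_def by simp

  \<comment> \<open>Forgetting \<open>y\<close> and \<open>\<nu>\<close>: this projection serves as
    the map both for the infima and for solvability.\<close>
  have weak: "fst v \<in> ?C \<and> ?F (fst v) \<le> ?F' v" if v: "v \<in> ?C'" for v
  proof -
    obtain x y \<nu> where vv: "v = (x, y, \<nu>)" by (cases v)
    have le: "worst_case Z f i x \<le> PW'_expr L c f i v" if i: "i \<in> {0..I}" for i
      unfolding worst_case_def vv
    proof (rule SUP_least)
      fix z assume "z \<in> Z"
      then show "f i x z \<le> PW'_expr L c f i (x, y, \<nu>)"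
        using v i unfolding vv
        by (intro PW'_expr_ge[where r = "fr i x z"] c_pcc f_fr[OF i]) (auto simp: PW'_constraints_def Z_def)
    qed
    have "worst_case Z f i x \<le> 0" if "i \<in> {1..I}" for i
      using le[of i] that v by (auto simp: PW'_constraints_def vv intro: order_trans)
    then show ?thesis
      using le[of 0] by (auto simp: vv PW_constraints_def sublevel_set_def PW_objective_def PW'_objective_def)
  qed
  have i: "optimal_value ?C ?F \<le> optimal_value ?C' ?F'"
    by (rule optimal_value_le_of_map[where \<pi> = fst]) (rule weak)

  have ii: "optimal_value ?C ?F = optimal_value ?C' ?F' \<and> (solvable ?C ?F \<longleftrightarrow> solvable ?C' ?F')"
    if slater: "slater_point {1..L} c z0" for z0
  proof -
    \<comment> \<open>The same \<open>x\<close> is kept and the worst cases themselves are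
      certified, so an optimal \<open>x\<close> extends to an optimal solution of the
      reformulation.\<close>
    have strong: "\<exists>v\<in>?C'. ?F' v \<le> ?F x" if x: "x \<in> ?C" "?F x \<noteq> \<infinity>" for x
    proof -
      define m where "m i = - real_of_ereal (worst_case Z f i x)" for i
      have ub: "worst_case Z f i x \<le> 0" if "i \<in> {1..I}" for i
        using x(1) that by (auto simp: PW_constraints_def sublevel_set_def)
      have fle: "f i x z \<le> worst_case Z f i x" if "z \<in> Z" for i z
        unfolding worst_case_def using that by (rule SUP_upper)
      have wm: "worst_case Z f i x = ereal (- m i)" if i: "i \<in> {0..I}" for i
      proof -
        obtain z where "z \<in> Z" using Z_nonempty by auto
        then have "worst_case Z f i x \<noteq> -\<infinity>" using fle[of z i] f_fr[OF i, of x z] by auto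
        moreover have "worst_case Z f i x \<noteq> \<infinity>"
        proof (cases "i = 0")
          case True
          then show ?thesis using x(2) by (simp add: PW_objective_def)
        next
          case False
          then show ?thesis using ub[of i] i by auto
        qed
        ultimately show ?thesis by (cases "worst_case Z f i x") (auto simp: m_def)
      qed
      have "dual_bound L c (\<lambda>z. - fr i x z) (m i)" if i: "i \<in> {0..I}" for i
      proof (rule dual_bound_slater[OF fr_concave[OF i] c_pcc slater])
        fix z assume "z \<in> sublevel_set {1..L} c"
        then show "m i \<le> - fr i x z" using fle[of z i] wm[OF i] f_fr[OF i, of x z] by (simp add: Z_def)
      qed
      moreover have "0 \<le> m i" if "i \<in> {1..I}" for i
        using ub[OF that] wm[of i] that by simp
      ultimately have "\<exists>v\<in>?C'. ?F' v \<le> ereal (- m 0)"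
        using f_fr by (intro dual_bounds_PW'[where g = "\<lambda>i z. - fr i x z"]) auto
      then show ?thesis using wm[of 0] by (simp add: PW_objective_def)
    qed
    have "optimal_value ?C' ?F' \<le> ?F x" if x: "x \<in> ?C" for x
    proof (cases "?F x = \<infinity>")
      case False
      then show ?thesis using strong[OF x] unfolding optimal_value_def by (meson INF_lower2)
    qed simp
    then have "optimal_value ?C' ?F' \<le> optimal_value ?C ?F"
      unfolding optimal_value_def[of ?C] by (rule INF_greatest)
    then have eq: "optimal_value ?C ?F = optimal_value ?C' ?F'" using i by simp
    have "solvable ?C' ?F'" if solv: "solvable ?C ?F"
    proof (cases "\<exists>x. feasible ?C ?F x")
      case True
      then obtain x where x: "feasible ?C ?F x" "?F x = optimal_value ?C ?F"
        using solv by (auto simp: solvable_def)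
      then have "\<exists>v\<in>?C'. ?F' v \<le> ?F x" by (intro strong) (simp_all add: feasible_def)
      then obtain v where v: "v \<in> ?C'" "?F' v \<le> ?F x" by blast
      have "optimal_value ?C' ?F' \<le> ?F' v" unfolding optimal_value_def using v(1) by (rule INF_lower)
      then have "?F' v = optimal_value ?C' ?F'" using v(2) x(2) eq by simp
      moreover have "feasible ?C' ?F' v" using v x(1) by (auto simp: feasible_def)
      ultimately show ?thesis unfolding solvable_def by blast
    next
      case False
      have "\<not> feasible ?C' ?F' v" for v
        using False weak[of v] by (auto simp: feasible_def)
      then show ?thesis by (simp add: solvable_def)
    qed
    moreover have "solvable ?C ?F" if "solvable ?C' ?F'"
      using weak eq that by (rule solvable_of_map)
    ultimately show ?thesis using eq by blast
  qed

  have iii: "optimal_value ?C ?F = optimal_value ?C' ?F' \<and> (solvable ?C' ?F' \<longrightarrow> solvable ?C ?F)"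
    if Z: "compact Z" and slater: "problem_strict_slater_point ?F {1..I} (worst_case Z f) xS" for xS
  proof -
    have "continuous_on Z (\<lambda>z. - fr i x z)" if "i \<in> {0..I}" for i x
      using convex_on_continuous[OF open_UNIV fr_concave[OF that]] continuous_on_subset by blast
    then have att: "\<exists>z\<in>Z. worst_case Z f i x = f i x z" if "i \<in> {0..I}" for i x
      using that f_fr[OF that] by (intro worst_case_attained[where g = "\<lambda>z. - fr i x z", OF Z Z_nonempty]) auto
    define w where "w i x = real_of_ereal (worst_case Z f i x)" for i x
    \<comment> \<open>Attainment on the compact set makes every worst case finite, at infeasible
      points too.\<close>
    have w: "worst_case Z f i x = ereal (w i x)" if "i \<in> {0..I}" for i x
      using att[OF that, of x] f_fr[OF that] by (auto simp: w_def)
    have fr_le: "fr i x z \<le> w i x" if "i \<in> {0..I}" "z \<in> Z" for i x z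
    proof -
      have "f i x z \<le> worst_case Z f i x" unfolding worst_case_def using that(2) by (rule SUP_upper)
      then show ?thesis using w f_fr that by simp
    qed
    have fr_mix: "fr i ((1 - t) *\<^sub>R x + t *\<^sub>R xS) z \<le> (1 - t) * w i x + t * w i xS"
      if "i \<in> {0..I}" "z \<in> Z" "0 \<le> t" "t \<le> 1" for i x z t
    proof -
      have "fr i ((1 - t) *\<^sub>R x + t *\<^sub>R xS) z \<le> (1 - t) * fr i x z + t * fr i xS z"
        using convex_onD[OF fr_convex[OF that(1)] that(3,4)] by simp
      also have "\<dots> \<le> (1 - t) * w i x + t * w i xS"
        using fr_le that by (intro add_mono mult_left_mono) auto
      finally show ?thesis .
    qed
    have "optimal_value ?C' ?F' \<le> ?F x" if x: "x \<in> ?C" for x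
    proof (rule ereal_le_epsilon2)
      fix e :: real assume e: "0 < e"
      define d where "d = w 0 xS - w 0 x"
      \<comment> \<open>The convexity bound for the objective at \<open>x'\<close> is
        \<open>w 0 x + t * d\<close>. This \<open>t\<close> keeps the increase below
        \<open>e\<close>, and the absolute value keeps it in (0, 1] for either sign of
        \<open>d\<close>.\<close>
      define t where "t = e / (e + \<bar>d\<bar>)"
      have t: "0 < t" "t \<le> 1" using e by (auto simp: t_def divide_le_eq)
      have "t * d < e"
      proof -
        have "e * d < e * (e + \<bar>d\<bar>)" using e by (intro mult_strict_left_mono) auto
        then show ?thesis using e by (simp add: t_def divide_less_eq)
      qed
      define x' where "x' = (1 - t) *\<^sub>R x + t *\<^sub>R xS"
      \<comment> \<open>Only the objective may lose \<open>e\<close>. The constraints keep the bound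
        0; the strictness that \<open>dual_bound_compact\<close> demands comes from
        \<open>w i xS < 0\<close> and \<open>t > 0\<close>.\<close>
      define m where "m i = (if i = 0 then - (w 0 x + e) else 0)" for i :: nat
      have less: "m i < - fr i x' z" if i: "i \<in> {0..I}" and z: "z \<in> Z" for i z
      proof -
        have "(1 - t) * w i x + t * w i xS < - m i"
        proof (cases "i = 0")
          case True
          then show ?thesis using \<open>t * d < e\<close> by (simp add: m_def d_def algebra_simps)
        next
          case False
          then have iI: "i \<in> {1..I}" using i by auto
          have "worst_case Z f i xS < 0"
            using slater iI by (simp add: problem_strict_slater_point_def strict_slater_point_def)
          then have "w i xS < 0" unfolding w[OF i] by simp
          moreover have "worst_case Z f i x \<le> 0"
            using x iI by (simp add: PW_constraints_def sublevel_set_def)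
          then have "w i x \<le> 0" unfolding w[OF i] by simp
          ultimately have "(1 - t) * w i x \<le> 0" "t * w i xS < 0"
            using t by (auto intro: mult_nonneg_nonpos mult_pos_neg)
          then show ?thesis using False by (simp add: m_def)
        qed
        then show ?thesis using fr_mix[OF i z, of t x] t by (simp add: x'_def)
      qed
      have "dual_bound L c (\<lambda>z. - fr i x' z) (m i)" if i: "i \<in> {0..I}" for i
        using Z Zne less[OF i] by (intro dual_bound_compact fr_concave c_pcc i) (auto simp: Z_def)
      then have "\<exists>v\<in>?C'. ?F' v \<le> ereal (- m 0)"
        using f_fr by (intro dual_bounds_PW'[where g = "\<lambda>i z. - fr i x' z" and x = x']) (auto simp: m_def)
      then have "optimal_value ?C' ?F' \<le> ereal (- m 0)"
        unfolding optimal_value_def by (meson INF_lower2)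
      then show "optimal_value ?C' ?F' \<le> ?F x + ereal e"
        using w[of 0 x] by (simp add: m_def PW_objective_def add.commute)
    qed
    then have "optimal_value ?C' ?F' \<le> optimal_value ?C ?F"
      unfolding optimal_value_def[of ?C] by (rule INF_greatest)
    then have eq: "optimal_value ?C ?F = optimal_value ?C' ?F'" using i by simp
    have "solvable ?C ?F" if "solvable ?C' ?F'"
      using weak eq that by (rule solvable_of_map)
    then show ?thesis using eq by blast
  qed
  show ?thesis using i ii iii by blast
qed

end
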